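(* Let $A\in\mathbb{R}^{m\times n}$, $(\bar b,\bar\lambda)\in\mathbb{R}^m\times\mathbb{R}_{++}$, and let $\bar x$ be a solution of the LASSO problem $\min_{x\in\mathbb{R}^n}\frac12\|Ax-\bar b\|^2+\bar\lambda\|x\|_1$. Let $I:=\mathrm{supp}(\bar x)$ and let $J:=\{i\in\{1,\dots,n\}:|A_i^T(\bar b-A\bar x)|=\bar\lambda\}$ be the equicorrelation set. Then the following hold for the solution map $$S:(b,\lambda)\mapsto\operatorname*{argmin}_{x\in\mathbb{R}^n}\left\{\tfrac12\|Ax-b\|^2+\lambda\|x\|_1\right\}.$$ (a) If $A_J$ has full column rank, then $S$ is locally Lipschitz at $(\bar b,\bar\lambda)$ with (local) Lipschitz modulus $$L\le\frac{1}{\sigma_{\min}(A_J)^2}\left(\sigma_{\max}(A_J)+\left\|\frac{A_J^T(A\bar x-\bar b)}{\bar\lambda}\right\|\right).$$ Moreover, $S$ is directionally differentiable at $(\bar b,\bar\lambda)$, and the directional derivative $S'((\bar b,\bar\lambda);(\cdot,\cdot)):\mathbb{R}^m\times\mathbb{R}\to\mathbb{R}^n$ is locally Lipschitz and given as follows: for $(q,\alpha)\in\mathbb{R}^m\times\mathbb{R}$ there exists an index set $K=K(q,\alpha)$ with $I\subseteq K\subseteq J$ such that $$S'((\bar b,\bar\lambda);(q,\alpha))=L_K\left((A_K^TA_K)^{-1}A_K^T\left(q+\frac{\alpha}{\bar\lambda}(A\bar x-\bar b)\right)\right).$$ (b) If $A_I$ has full column rank $|I|$ and $\|A_{I^C}^T(\bar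 b-A_I\bar x_I)\|_\infty<\bar\lambda$, then $S$ is continuously differentiable at $(\bar b,\bar\lambda)$ with derivative $$DS(\bar b,\bar\lambda)(q,\alpha)=L_I\left((A_I^TA_I)^{-1}A_I^T\left(q+\frac{\alpha}{\bar\lambda}(A\bar x-\bar b)\right)\right),\quad\forall(q,\alpha)\in\mathbb{R}^m\times\mathbb{R}.$$ In particular, $S$ is locally Lipschitz at $(\bar b,\bar\lambda)$ with constant $$L\le\frac{1}{\sigma_{\min}(A_I)^2}\left(\sigma_{\max}(A_I)+\left\|\frac{A_I^T(A\bar x-\bar b)}{\bar\lambda}\right\|\right).$$
   Context: $\|\cdot\|$ is the Euclidean norm (product spaces carry the Euclidean norm of the sum inner product), $\mathbb{R}_{++}=(0,\infty)$, $\mathrm{supp}(x)=\{i:x_i\ne0\}$, $I^C=\{1,\dots,n\}\setminus I$. $A_i$ is the $i$th column of $A$; $A_I$ is the submatrix of columns of $A$ indexed by $I$; $x_I$ is the subvector of $x$ indexed by $I$. $\sigma_{\min}(B)$ and $\sigma_{\max}(B)$ are the smallest positive and the largest singular value of a nonzero matrix $B$. For $M\subseteq\{1,\dots,n\}$, $L_M:\mathbb{R}^{|M|}\to\mathbb{R}^n$ is given by $L_M(r)_i=r_i$ for $i\in M$ and $0$ otherwise (embedding by zero padding, coordinates of $r$ being indexed by $M$). "Locally Lipschitz at $\bar u$" means: single-valued and Lipschitz on some neighborhood of $\bar u$; the (local) Lipschitz modulus is $L=\limsup_{u,u'\to\bar u,\,u\ne u'}\|S(u)-S(u')\|/\|u-u'\|$.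 Directionally differentiable means that $S'(\bar u;d)=\lim_{t\downarrow0}\frac{S(\bar u+td)-S(\bar u)}{t}$ exists for all $d$. Empty index sets: $A_K^{}$-expressions with $K=\emptyset$ are read as $0$, and the Lipschitz bounds for an empty index set are read as $0$. *)

theory Defs
  imports "HOL-Analysis.Analysis"
begin

section \<open>Submatrices and subvectors\<close>

text \<open>
  The index set \<open>K\<close> of a column submatrix \<open>A\<^sub>K\<close> is existentially quantified in the theorem, so it
  cannot be a type.  Throughout, objects whose indices range over a set \<open>K\<close> of type \<open>'n set\<close> are
  represented with the full index type \<open>'n\<close> and entries \<open>0\<close> outside \<open>K\<close>.  Products, transposes, the
  rank, Euclidean and maximum norms and the positive singular values are unaffected by the
  additional zero entries; only inverses of \<open>K \<times> K\<close> matrices need their own definition.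
\<close>

definition col_submatrix :: "real^'n^'m \<Rightarrow> 'n set \<Rightarrow> real^'n^'m" where
  "col_submatrix A K = (\<chi> i j. if j \<in> K then A $ i $ j else 0)"

definition subvector :: "real^'n \<Rightarrow> 'n set \<Rightarrow> real^'n" where
  "subvector x K = (\<chi> i. if i \<in> K then x $ i else 0)"

text \<open>The zero-padding map \<open>L\<^sub>M\<close>; it reads only the coordinates of \<open>r\<close> in \<open>M\<close>.\<close>

definition pad :: "'n set \<Rightarrow> real^'n \<Rightarrow> real^'n" where
  "pad M r = (\<chi> i. if i \<in> M then r $ i else 0)"

definition full_col_rank_on :: "real^'n^'m \<Rightarrow> 'n set \<Rightarrow> bool" where
  "full_col_rank_on A K \<longleftrightarrow> rank (col_submatrix A K) = card K"

text \<open>Entries of \<open>M\<close> outside \<open>K \<times> K\<close> are not read; those of \<open>N\<close> are fixed to be \<open>0\<close>, which makes \<open>N\<close> unique.\<close>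

definition is_inverse_on :: "'n set \<Rightarrow> real^'n^'n \<Rightarrow> real^'n^'n \<Rightarrow> bool" where
  "is_inverse_on K M N \<longleftrightarrow>
     (\<forall>i j. i \<notin> K \<or> j \<notin> K \<longrightarrow> N $ i $ j = 0) \<and>
     (\<forall>i\<in>K. \<forall>j\<in>K. (\<Sum>k\<in>K. M $ i $ k * N $ k $ j) = (if i = j then 1 else 0)) \<and>
     (\<forall>i\<in>K. \<forall>j\<in>K. (\<Sum>k\<in>K. N $ i $ k * M $ k $ j) = (if i = j then 1 else 0))"

definition inverse_on :: "'n set \<Rightarrow> real^'n^'n \<Rightarrow> real^'n^'n" where
  "inverse_on K M = (THE N. is_inverse_on K M N)"

lemma is_inverse_on_unique:
  fixes M N N' :: "real^'n^'n"
  assumes N: "is_inverse_on K M N" and N': "is_inverse_on K M N'"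
  shows "N = N'"
proof -
  have "N $ i $ j = N' $ i $ j" if i: "i \<in> K" and j: "j \<in> K" for i j
  proof -
    have "N $ i $ j = (\<Sum>k\<in>K. N $ i $ k * (if k = j then 1 else 0))"
      using j by (simp add: if_distrib sum.delta cong: if_cong)
    also have "\<dots> = (\<Sum>k\<in>K. N $ i $ k * (\<Sum>l\<in>K. M $ k $ l * N' $ l $ j))"
      using N' j by (intro sum.cong) (auto simp: is_inverse_on_def)
    also have "\<dots> = (\<Sum>l\<in>K. (\<Sum>k\<in>K. N $ i $ k * M $ k $ l) * N' $ l $ j)"
      unfolding sum_distrib_left sum_distrib_right
      by (subst sum.swap) (simp add: mult.assoc)
    also have "\<dots> = (\<Sum>l\<in>K. (if i = l then 1 else 0) * N' $ l $ j)"
      using N i by (intro sum.cong) (auto simp: is_inverse_on_def)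
    also have "\<dots> = N' $ i $ j"
      using i by (simp add: if_distrib if_distribR sum.delta' cong: if_cong)
    finally show ?thesis .
  qed
  moreover have "N $ i $ j = N' $ i $ j" if "i \<notin> K \<or> j \<notin> K" for i j
    using N N' that unfolding is_inverse_on_def by auto
  ultimately show ?thesis
    unfolding vec_eq_iff by blast
qed

lemma inverse_on_eqI:
  "is_inverse_on K M N \<Longrightarrow> inverse_on K M = N"
  unfolding inverse_on_def by (blast intro: the_equality is_inverse_on_unique)

section \<open>Singular values\<close>

text \<open>
  Square roots of the eigenvalues of \<open>B\<^sup>TB\<close>.  For a zero-padded column submatrix this set may
  contain an additional \<open>0\<close>, which affects neither the largest singular value nor the smallest
  positive one.
\<close>

definition singular_values :: "real^'n^'m \<Rightarrow> real set" where
  "singular_values B =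
     {s. 0 \<le> s \<and> (\<exists>v. v \<noteq> 0 \<and> (transpose B ** B) *v v = s\<^sup>2 *\<^sub>R v)}"

definition sigma_max :: "real^'n^'m \<Rightarrow> real" where
  "sigma_max B = Max (singular_values B)"

definition sigma_min :: "real^'n^'m \<Rightarrow> real" where
  "sigma_min B = Min {s \<in> singular_values B. 0 < s}"

section \<open>The LASSO problem\<close>

definition l1_norm :: "real^'n \<Rightarrow> real" where
  "l1_norm x = (\<Sum>i\<in>UNIV. \<bar>x $ i\<bar>)"

definition lasso_objective :: "real^'n^'m \<Rightarrow> (real^'m) \<times> real \<Rightarrow> real^'n \<Rightarrow> real" where
  "lasso_objective A = (\<lambda>(b, lam) x. 1/2 * (norm (A *v x - b))\<^sup>2 + lam * l1_norm x)"

definition lasso_sol :: "real^'n^'m \<Rightarrow> (real^'m) \<times> real \<Rightarrow> (real^'n) set" where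
  "lasso_sol A u = {x. is_arg_min (lasso_objective A u) (\<lambda>_. True) x}"

definition supp :: "real^'n \<Rightarrow> 'n set" where
  "supp x = {i. x $ i \<noteq> 0}"

definition equicorrelation_set :: "real^'n^'m \<Rightarrow> real^'m \<Rightarrow> real \<Rightarrow> real^'n \<Rightarrow> 'n set" where
  "equicorrelation_set A b lam x = {i. \<bar>column i A \<bullet> (b - A *v x)\<bar> = lam}"

definition lasso_lipschitz_bound ::
    "real^'n^'m \<Rightarrow> real^'m \<Rightarrow> real \<Rightarrow> real^'n \<Rightarrow> 'n set \<Rightarrow> real" where
  "lasso_lipschitz_bound A b lam x K =
     (if K = {} then 0
      else 1 / (sigma_min (col_submatrix A K))\<^sup>2 *
           (sigma_max (col_submatrix A K) +
            norm ((1 / lam) *\<^sub>R (transpose (col_submatrix A K) *v (A *v x - b)))))"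

text \<open>The vector \<open>L\<^sub>K ((A\<^sub>K\<^sup>T A\<^sub>K)\<^sup>-\<^sup>1 A\<^sub>K\<^sup>T (q + \<alpha>/\<lambda> (A x - b)))\<close>; it is \<open>0\<close> for empty \<open>K\<close>.\<close>

definition lasso_derivative ::
    "real^'n^'m \<Rightarrow> real^'m \<Rightarrow> real \<Rightarrow> real^'n \<Rightarrow> 'n set \<Rightarrow> (real^'m) \<times> real \<Rightarrow> real^'n" where
  "lasso_derivative A b lam x K = (\<lambda>(q, \<alpha>).
     pad K (inverse_on K (transpose (col_submatrix A K) ** col_submatrix A K) *v
            (transpose (col_submatrix A K) *v (q + (\<alpha> / lam) *\<^sub>R (A *v x - b)))))"

section \<open>Local regularity of maps\<close>

definition locally_lipschitz_at ::
    "('a::real_normed_vector \<Rightarrow> 'b::real_normed_vector) \<Rightarrow> 'a \<Rightarrow> bool" where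
  "locally_lipschitz_at f u \<longleftrightarrow> (\<exists>U C. open U \<and> u \<in> U \<and> C-lipschitz_on U f)"

text \<open>The modulus takes values in the extended reals, so that it is meaningful for every map.\<close>

definition lipschitz_modulus ::
    "('a::real_normed_vector \<Rightarrow> 'b::real_normed_vector) \<Rightarrow> 'a \<Rightarrow> ereal" where
  "lipschitz_modulus f u =
     Limsup (at (u, u) within {(v, w). v \<noteq> w})
       (\<lambda>(v, w). ereal (norm (f v - f w) / norm (v - w)))"

definition has_directional_derivative ::
    "('a::real_normed_vector \<Rightarrow> 'b::real_normed_vector) \<Rightarrow> 'a \<Rightarrow> 'a \<Rightarrow> 'b \<Rightarrow> bool" where
  "has_directional_derivative f u d D \<longleftrightarrow>
     ((\<lambda>t. (1 / t) *\<^sub>R (f (u + t *\<^sub>R d) - f u)) \<longlongrightarrow> D) (at_right 0)"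

definition directionally_differentiable ::
    "('a::real_normed_vector \<Rightarrow> 'b::real_normed_vector) \<Rightarrow> 'a \<Rightarrow> bool" where
  "directionally_differentiable f u \<longleftrightarrow> (\<forall>d. \<exists>D. has_directional_derivative f u d D)"

definition directional_derivative ::
    "('a::real_normed_vector \<Rightarrow> 'b::real_normed_vector) \<Rightarrow> 'a \<Rightarrow> 'a \<Rightarrow> 'b" where
  "directional_derivative f u d = (THE D. has_directional_derivative f u d D)"

text \<open>Read as: continuously Frechet differentiable on a whole neighbourhood of the point.\<close>

definition continuously_differentiable_at ::
    "('a::real_normed_vector \<Rightarrow> 'b::real_normed_vector) \<Rightarrow> 'a \<Rightarrow> bool" where
  "continuously_differentiable_at f u \<longleftrightarrow>
     (\<exists>U (f' :: 'a \<Rightarrow> 'a \<Rightarrow>\<^sub>L 'b). open U \<and> u \<in> U \<and>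
        (\<forall>v\<in>U. (f has_derivative blinfun_apply (f' v)) (at v)) \<and> continuous_on U f')"

text \<open>
  A set-valued map that is single-valued on a neighbourhood of \<open>u\<close> is identified there with the
  function \<open>single_value S\<close>.  The values of that function away from such a neighbourhood are
  irrelevant for the local notions above.
\<close>

definition single_valued_near :: "('a::topological_space \<Rightarrow> 'b set) \<Rightarrow> 'a \<Rightarrow> bool" where
  "single_valued_near S u \<longleftrightarrow> (\<exists>U. open U \<and> u \<in> U \<and> (\<forall>v\<in>U. is_singleton (S v)))"

definition single_value :: "('a \<Rightarrow> 'b set) \<Rightarrow> 'a \<Rightarrow> 'b" where
  "single_value S v = the_elem (S v)"

end

theory Submission
  imports Defs
begin

text \<open>
  Comparing the variational inequalities of two LASSO solutions \<open>x1\<close>, \<open>x2\<close> for data \<open>(b1, lam1)\<close>,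
  \<open>(b2, lam2)\<close>, with residual \<open>r2 = b2 - A x2\<close>, gives
  \<open>\<parallel>A (x1 - x2)\<parallel>\<^sup>2 \<le> (b1 - b2) \<bullet> A (x1 - x2) - (lam1 - lam2) / lam2 * (r2 \<bullet> A (x1 - x2))\<close>
  (\<open>lasso_stability\<close>).  Hence residuals depend continuously on the data, the strict inequalities
  of the correlations off the equicorrelation set \<open>J\<close> persist, and all solutions for nearby data are
  supported in \<open>J\<close>.  If \<open>A\<close> is injective on vectors supported in \<open>J\<close>, the smallest positive singular
  value of \<open>A\<^sub>J\<close> (for nonempty \<open>J\<close>) bounds the left-hand side from below, and the same inequality yields uniqueness and the
  Lipschitz estimate at once (\<open>lasso_lipschitz_near\<close>).  The constant tends to the asserted
  bound because \<open>A\<^sub>J\<^sup>T r2 / lam2\<close> is continuous in the data.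

  Near \<open>(b, lam)\<close> the signs of the correlations on \<open>J\<close> and of the solution on the support of \<open>x\<close> do
  not change.  Subtracting the optimality conditions at \<open>(b, lam)\<close> from those at \<open>(b, lam) + (q, \<alpha>)\<close>
  therefore leaves a positively homogeneous complementarity system for the increment of the solution
  (\<open>critical_direction\<close>, \<open>eventually_critical_direction\<close>), whose solutions are unique.  So the
  solution map is linear on short segments starting at \<open>(b, lam)\<close>, which proves directional
  differentiability without a limit argument; the slope \<open>w\<close> solves the normal equations on
  \<open>K = supp x \<union> supp w\<close>.  The slopes inherit the Lipschitz constant of the solution map.  If
  \<open>J = supp x\<close>, then \<open>K\<close> is the same set for all directions and the solution map is affine near
  \<open>(b, lam)\<close>.
\<close>

(* The default rewriting of transposed products into vector-matrix products is switched off,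
   since all statements below are in terms of the transpose. *)
declare transpose_matrix_vector [simp del]

section \<open>Zero padding and column submatrices\<close>

lemma supp_subset_iff: "supp z \<subseteq> K \<longleftrightarrow> (\<forall>i. i \<notin> K \<longrightarrow> z $ i = 0)"
  by (auto simp: supp_def)

lemma supp_diff_subset: "supp y \<subseteq> K \<Longrightarrow> supp z \<subseteq> K \<Longrightarrow> supp (y - z) \<subseteq> K"
  by (auto simp: supp_subset_iff)

lemma subspace_supp_subset: "subspace {z :: real^'n. supp z \<subseteq> K}"
  by (auto simp: subspace_def supp_subset_iff)

lemma inner_matrix_vector_mult:
  fixes A :: "real^'n^'m"
  shows "y \<bullet> (A *v z) = (transpose A *v y) \<bullet> z"
  by (simp add: dot_lmul_matrix transpose_matrix_vector)

lemma transpose_mult_component: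
  fixes A :: "real^'n^'m"
  shows "(transpose A *v y) $ i = column i A \<bullet> y"
  by (simp add: matrix_vector_mult_def transpose_def column_def inner_vec_def)

lemma inner_matrix_vector_sum:
  fixes A :: "real^'n^'m"
  shows "y \<bullet> (A *v z) = (\<Sum>i\<in>UNIV. (column i A \<bullet> y) * z $ i)"
  unfolding inner_matrix_vector_mult
  by (simp add: inner_vec_def[of "transpose A *v y"] transpose_mult_component)

lemma col_submatrix_mult:
  assumes "supp z \<subseteq> K"
  shows "col_submatrix A K *v z = A *v z"
  using assms unfolding supp_subset_iff col_submatrix_def matrix_vector_mult_def vec_eq_iff
  by (auto intro!: sum.cong)

lemma transpose_col_submatrix_component:
  "(transpose (col_submatrix A K) *v y) $ i = (if i \<in> K then column i A \<bullet> y else 0)"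
  by (simp add: transpose_mult_component col_submatrix_def column_def inner_vec_def)

lemma supp_transpose_col_submatrix: "supp (transpose (col_submatrix A K) *v y) \<subseteq> K"
  by (auto simp: supp_subset_iff transpose_col_submatrix_component)

text \<open>
  The columns indexed by \<open>K\<close> span a space of dimension \<open>card K\<close>, hence they are distinct and linearly
  independent.
\<close>

lemma full_col_rank_on_injective:
  fixes A :: "real^'n^'m"
  assumes rk: "full_col_rank_on A K" and z: "supp z \<subseteq> K" and Az: "A *v z = 0"
  shows "z = 0"
proof -
  define f where "f = (\<lambda>i. column i A)"
  have "range (\<lambda>x. col_submatrix A K *v x) \<subseteq> span (f ` K)"
  proof clarify
    fix y :: "real^'n"
    have "col_submatrix A K *v y = (\<Sum>i\<in>K. y $ i *\<^sub>R f i)"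
      unfolding vec_eq_iff
      by (auto simp: matrix_vector_mult_def col_submatrix_def f_def column_def if_distrib if_distribR
          sum.If_cases mult.commute cong: if_cong)
    also have "\<dots> \<in> span (f ` K)"
      by (intro span_sum span_mul span_base) auto
    finally show "col_submatrix A K *v y \<in> span (f ` K)" .
  qed
  then have "card K \<le> dim (f ` K)"
    using rk unfolding full_col_rank_on_def rank_dim_range by (metis dim_span dim_subset)
  moreover have "dim (f ` K) \<le> card (f ` K)" "card (f ` K) \<le> card K"
    by (simp_all add: dim_le_card' card_image_le)
  ultimately have eq: "card (f ` K) = card K" "card (f ` K) \<le> dim (f ` K)"
    by linarith+
  have inj: "inj_on f K"
    using eq(1) by (intro eq_card_imp_inj_on) auto
  have ind: "independent (f ` K)"
    using eq(2) by (intro card_le_dim_spanning[of _ "f ` K"]) (auto intro: span_base)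
  have "A *v z = (\<Sum>i\<in>K. z $ i *\<^sub>R f i)"
  proof -
    have "A *v z = (\<Sum>i\<in>UNIV. z $ i *\<^sub>R f i)"
      by (simp add: matrix_mult_sum f_def scalar_mult_eq_scaleR)
    also have "\<dots> = (\<Sum>i\<in>K. z $ i *\<^sub>R f i)"
      using z by (intro sum.mono_neutral_right) (auto simp: supp_subset_iff)
    finally show ?thesis .
  qed
  also have "\<dots> = (\<Sum>v\<in>f ` K. z $ (the_inv_into K f v) *\<^sub>R v)"
    using inj by (subst sum.reindex) (auto simp: the_inv_into_f_f)
  finally have "(\<Sum>v\<in>f ` K. z $ (the_inv_into K f v) *\<^sub>R v) = 0"
    using Az by simp
  then have "\<forall>v\<in>f ` K. z $ (the_inv_into K f v) = 0"
    using ind by (subst (asm) independent_explicit) auto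
  then have "z $ i = 0" if "i \<in> K" for i
    using that inj by (auto simp: the_inv_into_f_f)
  then show ?thesis
    using z by (auto simp: vec_eq_iff supp_subset_iff)
qed

section \<open>Gram matrices on an index set\<close>

lemma is_inverse_on_exists:
  fixes G :: "real^'n^'n"
  assumes supp: "\<And>i j. i \<notin> K \<or> j \<notin> K \<Longrightarrow> G $ i $ j = 0"
    and inj: "\<And>z. supp z \<subseteq> K \<Longrightarrow> G *v z = 0 \<Longrightarrow> z = 0"
  shows "\<exists>N. is_inverse_on K G N"
proof -
  \<comment> \<open>Extending the \<open>K \<times> K\<close> block by an identity block gives an invertible matrix of full size.\<close>
  define M :: "real^'n^'n" where "M = (\<chi> i j. G $ i $ j + (if i = j \<and> i \<notin> K then 1 else 0))"
  have Mv: "(M *v v) $ i = (G *v v) $ i + (if i \<in> K then 0 else v $ i)" for v i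
  proof -
    have "(M *v v) $ i = (\<Sum>j\<in>UNIV. G $ i $ j * v $ j + (if i = j then (if i \<in> K then 0 else v $ i) else 0))"
      unfolding matrix_vector_mult_def M_def by (auto simp: algebra_simps intro!: sum.cong)
    then show ?thesis
      by (simp add: sum.distrib matrix_vector_mult_def)
  qed
  have G0: "(G *v v) $ i = 0" if "i \<notin> K" for v i
    using supp that by (simp add: matrix_vector_mult_def)
  have "v = 0" if "M *v v = 0" for v
  proof (rule inj)
    have *: "(G *v v) $ i + (if i \<in> K then 0 else v $ i) = 0" for i
      using that Mv[of v i] by simp
    show "supp v \<subseteq> K"
      using * G0 unfolding supp_subset_iff by (metis add_0)
    show "G *v v = 0"
      using * G0 unfolding vec_eq_iff by (metis add.right_neutral zero_index)
  qed
  then obtain N where N: "N ** M = mat 1"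
    using matrix_left_invertible_ker[of M] by auto
  then have N': "M ** N = mat 1"
    by (simp add: matrix_left_right_inverse)
  define R :: "real^'n^'n" where "R = (\<chi> i j. if i \<in> K \<and> j \<in> K then N $ i $ j else 0)"
  have "(\<Sum>k\<in>K. G $ i $ k * R $ k $ j) = (if i = j then 1 else 0)" if "i \<in> K" "j \<in> K" for i j
  proof -
    have "(\<Sum>k\<in>K. G $ i $ k * R $ k $ j) = (\<Sum>k\<in>UNIV. M $ i $ k * N $ k $ j)"
      using that supp by (intro sum.mono_neutral_cong_left) (auto simp: M_def R_def)
    also have "\<dots> = (M ** N) $ i $ j"
      by (simp add: matrix_matrix_mult_def)
    finally show ?thesis
      by (simp add: N' mat_def)
  qed
  moreover have "(\<Sum>k\<in>K. R $ i $ k * G $ k $ j) = (if i = j then 1 else 0)"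
    if "i \<in> K" "j \<in> K" for i j
  proof -
    have "(\<Sum>k\<in>K. R $ i $ k * G $ k $ j) = (\<Sum>k\<in>UNIV. N $ i $ k * M $ k $ j)"
      using that supp by (intro sum.mono_neutral_cong_left) (auto simp: M_def R_def)
    also have "\<dots> = (N ** M) $ i $ j"
      by (simp add: matrix_matrix_mult_def)
    finally show ?thesis
      by (simp add: N mat_def)
  qed
  ultimately have "is_inverse_on K G R"
    by (auto simp: is_inverse_on_def R_def)
  then show ?thesis ..
qed

lemma pad_inverse_on_Gram:
  fixes A :: "real^'n^'m"
  assumes inj: "\<And>z. supp z \<subseteq> K \<Longrightarrow> A *v z = 0 \<Longrightarrow> z = 0" and w: "supp w \<subseteq> K"
  defines "B \<equiv> col_submatrix A K"
  shows "pad K (inverse_on K (transpose B ** B) *v (transpose B *v (B *v w))) = w"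
proof -
  define G where "G = transpose B ** B"
  have G0: "G $ i $ j = 0" if "i \<notin> K \<or> j \<notin> K" for i j
    using that by (auto simp: G_def B_def col_submatrix_def transpose_def matrix_matrix_mult_def)
  have "z = 0" if z: "supp z \<subseteq> K" and "G *v z = 0" for z
  proof -
    have "norm (B *v z) ^ 2 = (G *v z) \<bullet> z"
      by (simp add: power2_norm_eq_inner inner_matrix_vector_mult G_def matrix_vector_mul_assoc)
    then have "B *v z = 0"
      using that by simp
    then show ?thesis
      using inj z by (simp add: B_def col_submatrix_mult)
  qed
  then obtain N where N: "is_inverse_on K G N"
    using is_inverse_on_exists G0 by blast
  have Gw: "(G *v w) $ k = (\<Sum>j\<in>K. G $ k $ j * w $ j)" for k
    unfolding matrix_vector_mult_def using w
    by (auto simp: supp_subset_iff intro!: sum.mono_neutral_right)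
  have "(N *v (G *v w)) $ i = w $ i" if i: "i \<in> K" for i
  proof -
    have "(N *v (G *v w)) $ i = (\<Sum>k\<in>K. N $ i $ k * (G *v w) $ k)"
      unfolding matrix_vector_mult_def[of N] using N
      by (auto simp: is_inverse_on_def intro!: sum.mono_neutral_right)
    also have "\<dots> = (\<Sum>j\<in>K. (\<Sum>k\<in>K. N $ i $ k * G $ k $ j) * w $ j)"
      unfolding Gw sum_distrib_left sum_distrib_right
      by (subst sum.swap) (simp add: mult.assoc)
    also have "\<dots> = (\<Sum>j\<in>K. (if i = j then 1 else 0) * w $ j)"
      using N i by (intro sum.cong) (auto simp: is_inverse_on_def)
    also have "\<dots> = w $ i"
      using i by (simp add: if_distrib if_distribR sum.delta' cong: if_cong)
    finally show ?thesis .
  qed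
  then have "pad K (N *v (G *v w)) = w"
    using w by (auto simp: pad_def vec_eq_iff supp_subset_iff)
  then show ?thesis
    using inverse_on_eqI[OF N]
    by (simp add: G_def matrix_vector_mul_assoc)
qed

text \<open>The derivative formula is characterized by the normal equations on \<open>K\<close>.\<close>

lemma lasso_derivative_eqI:
  fixes A :: "real^'n^'m"
  assumes inj: "\<And>z. supp z \<subseteq> K \<Longrightarrow> A *v z = 0 \<Longrightarrow> z = 0" and w: "supp w \<subseteq> K"
    and eq: "\<And>i. i \<in> K \<Longrightarrow>
      column i A \<bullet> (q - A *v w) = \<alpha> / lam * (column i A \<bullet> (b - A *v x))"
  shows "lasso_derivative A b lam x K (q, \<alpha>) = w"
proof -
  define B where "B = col_submatrix A K"
  have "transpose B *v (q + (\<alpha> / lam) *\<^sub>R (A *v x - b)) = transpose B *v (B *v w)"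
    unfolding vec_eq_iff
  proof
    fix i
    have "column i A \<bullet> (q + (\<alpha> / lam) *\<^sub>R (A *v x - b)) = column i A \<bullet> (A *v w)" if "i \<in> K"
      using eq[OF that] by (simp add: inner_add_right inner_diff_right algebra_simps)
    then show "(transpose B *v (q + (\<alpha> / lam) *\<^sub>R (A *v x - b))) $ i
        = (transpose B *v (B *v w)) $ i"
      using w by (simp add: B_def transpose_col_submatrix_component col_submatrix_mult)
  qed
  then show ?thesis
    using pad_inverse_on_Gram[OF inj w]
    by (simp add: lasso_derivative_def B_def)
qed

lemma linear_lasso_derivative: "linear (lasso_derivative A b lam x K)"
proof -
  have pad: "linear (pad K)"
    by (intro linearI) (auto simp: pad_def vec_eq_iff)
  define M where "M = inverse_on K (transpose (col_submatrix A K) ** col_submatrix A K)"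
  define T where "T = transpose (col_submatrix A K)"
  have "lasso_derivative A b lam x K
      = pad K \<circ> (\<lambda>z. M *v z) \<circ> (\<lambda>z. T *v z) \<circ> (\<lambda>u. fst u + (snd u / lam) *\<^sub>R (A *v x - b))"
    by (auto simp: lasso_derivative_def fun_eq_iff M_def T_def)
  moreover have "linear (\<lambda>u. fst u + (snd u / lam) *\<^sub>R (A *v x - b))"
    by (intro linearI) (auto simp: algebra_simps add_divide_distrib)
  ultimately show ?thesis
    by (auto intro!: linear_compose pad)
qed

section \<open>Extreme singular values\<close>

lemma quadratic_nonneg_imp_linear_coeff_0:
  fixes p r :: real
  assumes "\<And>t. 0 \<le> 2 * t * p + t\<^sup>2 * r"
  shows "p = 0"
proof (rule ccontr)
  assume p: "p \<noteq> 0"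
  define k where "k = \<bar>r\<bar> + 1"
  have k: "0 < k" "r \<le> k" by (auto simp: k_def)
  have "2 * (- p / k) * p + (- p / k)\<^sup>2 * r = (p\<^sup>2 / k) * (r / k - 2)"
    using k by (simp add: field_simps power2_eq_square)
  moreover have "0 < p\<^sup>2 / k" "r / k - 2 < 0"
    using p k by (auto simp: field_simps)
  ultimately show False
    using assms[of "- p / k"] by (metis linorder_not_less mult_pos_neg)
qed

text \<open>
  Rayleigh's principle: an extremal vector of \<open>\<parallel>B z\<parallel>\<^sup>2 - \<mu> \<parallel>z\<parallel>\<^sup>2\<close> on a subspace is an
  eigenvector of \<open>B\<^sup>T B\<close>, provided that \<open>B\<^sup>T B\<close> does not map it out of the subspace.  The sign \<open>\<kappa>\<close> covers minima and maxima.
\<close>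

lemma extremal_imp_eigenvector:
  fixes B :: "real^'n^'m"
  assumes V: "subspace V" and v: "v \<in> V" and inv: "transpose B *v (B *v v) \<in> V"
    and \<kappa>: "\<kappa> \<noteq> 0"
    and ge: "\<And>z. z \<in> V \<Longrightarrow> 0 \<le> \<kappa> * ((norm (B *v z))\<^sup>2 - \<mu> * (norm z)\<^sup>2)"
    and eq: "(norm (B *v v))\<^sup>2 = \<mu> * (norm v)\<^sup>2"
  shows "transpose B *v (B *v v) = \<mu> *\<^sub>R v"
proof -
  define z where "z = transpose B *v (B *v v) - \<mu> *\<^sub>R v"
  have zV: "z \<in> V"
    unfolding z_def using V v inv by (intro subspace_diff subspace_scale)
  have "0 \<le> 2 * t * (\<kappa> * ((B *v v) \<bullet> (B *v z) - \<mu> * (v \<bullet> z)))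
      + t\<^sup>2 * (\<kappa> * ((norm (B *v z))\<^sup>2 - \<mu> * (norm z)\<^sup>2))" for t
  proof -
    have "v + t *\<^sub>R z \<in> V"
      using V v zV by (intro subspace_add subspace_scale)
    then have "0 \<le> \<kappa> * ((norm (B *v (v + t *\<^sub>R z)))\<^sup>2 - \<mu> * (norm (v + t *\<^sub>R z))\<^sup>2)"
      by (rule ge)
    also have "\<dots> = \<kappa> * ((norm (B *v v))\<^sup>2 - \<mu> * (norm v)\<^sup>2)
        + 2 * t * (\<kappa> * ((B *v v) \<bullet> (B *v z) - \<mu> * (v \<bullet> z)))
        + t\<^sup>2 * (\<kappa> * ((norm (B *v z))\<^sup>2 - \<mu> * (norm z)\<^sup>2))"
      unfolding power2_norm_eq_inner matrix_vector_right_distrib matrix_vector_mult_scaleR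
      by (simp add: inner_add_left inner_add_right inner_commute algebra_simps power2_eq_square)
    finally show ?thesis
      using eq by simp
  qed
  then have "\<kappa> * ((B *v v) \<bullet> (B *v z) - \<mu> * (v \<bullet> z)) = 0"
    by (rule quadratic_nonneg_imp_linear_coeff_0)
  then have "(transpose B *v (B *v v)) \<bullet> z - \<mu> * (v \<bullet> z) = 0"
    using \<kappa> by (simp add: inner_matrix_vector_mult)
  then have "z \<bullet> z = 0"
    by (subst z_def) (simp add: inner_diff_left)
  then show ?thesis
    by (simp add: z_def)
qed

lemma finite_singular_values:
  fixes B :: "real^'n^'m"
  shows "finite (singular_values B)"
proof -
  define G where "G = transpose B ** B"
  have "\<forall>s\<in>singular_values B. \<exists>v. v \<noteq> 0 \<and> G *v v = s\<^sup>2 *\<^sub>R v"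
    by (auto simp: singular_values_def G_def)
  then obtain e where e: "\<And>s. s \<in> singular_values B \<Longrightarrow> e s \<noteq> 0 \<and> G *v e s = s\<^sup>2 *\<^sub>R e s"
    by metis
  have orth: "e s \<bullet> e t = 0" if st: "s \<in> singular_values B" "t \<in> singular_values B" "s \<noteq> t" for s t
  proof -
    have "transpose G = G"
      by (simp add: G_def matrix_transpose_mul)
    then have "e s \<bullet> (G *v e t) = (G *v e s) \<bullet> e t"
      using inner_matrix_vector_mult[of "e s" G "e t"] by simp
    then have "(s\<^sup>2 - t\<^sup>2) * (e s \<bullet> e t) = 0"
      using e st by (auto simp: algebra_simps)
    moreover have "s\<^sup>2 \<noteq> t\<^sup>2"
      using st by (auto simp: singular_values_def)
    ultimately show ?thesis by simp
  qed
  have "pairwise orthogonal (e ` singular_values B)"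
    unfolding pairwise_def orthogonal_def using orth by blast
  then have "finite (e ` singular_values B)"
    by (rule pairwise_orthogonal_imp_finite)
  moreover have "inj_on e (singular_values B)"
    using orth e by (intro inj_onI) (metis inner_eq_zero_iff)
  ultimately show ?thesis
    by (rule finite_imageD)
qed

lemma extremal_singular_value:
  fixes B :: "real^'n^'m"
  assumes "v \<noteq> 0" "0 \<le> \<mu>" "transpose B *v (B *v v) = \<mu> *\<^sub>R v"
  shows "sqrt \<mu> \<in> singular_values B"
  using assms by (auto simp: singular_values_def matrix_vector_mul_assoc
      intro!: exI[of _ v])

lemma norm_mult_le_sigma_max:
  fixes B :: "real^'n^'m"
  shows "0 \<le> sigma_max B" "norm (B *v z) \<le> sigma_max B * norm z"
proof -
  define \<phi> where "\<phi> = (\<lambda>z. norm (B *v z))"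
  have cont: "continuous_on (sphere 0 1) \<phi>"
    unfolding \<phi>_def by (intro continuous_intros)
  have "sphere (0 :: real^'n) 1 \<noteq> {}"
    using vector_choose_size[of 1] by auto
  then obtain v where v: "norm v = 1" and max: "\<And>y. norm y = 1 \<Longrightarrow> \<phi> y \<le> \<phi> v"
    using continuous_attains_sup[OF compact_sphere _ cont] by auto
  have le: "norm (B *v y) \<le> \<phi> v * norm y" for y
  proof (cases "y = 0")
    case False
    have "\<phi> (y /\<^sub>R norm y) \<le> \<phi> v"
      using False by (intro max) simp
    then show ?thesis
      using False by (simp add: \<phi>_def matrix_vector_mult_scaleR field_simps)
  qed simp
  have "transpose B *v (B *v v) = (\<phi> v)\<^sup>2 *\<^sub>R v"
  proof (rule extremal_imp_eigenvector[where V = UNIV and \<kappa> = "-1"])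
    fix z
    have "(norm (B *v z))\<^sup>2 \<le> (\<phi> v)\<^sup>2 * (norm z)\<^sup>2"
      using power_mono[OF le[of z], of 2] by (simp add: power_mult_distrib)
    then show "0 \<le> - 1 * ((norm (B *v z))\<^sup>2 - (\<phi> v)\<^sup>2 * (norm z)\<^sup>2)"
      by simp
  qed (use v in \<open>auto simp: \<phi>_def\<close>)
  then have "sqrt ((\<phi> v)\<^sup>2) \<in> singular_values B"
    using v by (intro extremal_singular_value) auto
  then have "\<phi> v \<in> singular_values B"
    by (simp add: \<phi>_def)
  then have "\<phi> v \<le> sigma_max B"
    unfolding sigma_max_def by (intro Max_ge finite_singular_values)
  moreover have "0 \<le> \<phi> v"
    by (simp add: \<phi>_def)
  ultimately show "0 \<le> sigma_max B" and "norm (B *v z) \<le> sigma_max B * norm z"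
    using order_trans[OF le[of z] mult_right_mono[of "\<phi> v" "sigma_max B" "norm z"]] by auto
qed

lemma sigma_min_mult_norm_le:
  fixes A :: "real^'n^'m"
  assumes inj: "\<And>z. supp z \<subseteq> K \<Longrightarrow> A *v z = 0 \<Longrightarrow> z = 0" and K: "K \<noteq> {}"
  defines "\<sigma> \<equiv> sigma_min (col_submatrix A K)"
  shows "0 < \<sigma>" "supp z \<subseteq> K \<Longrightarrow> \<sigma> * norm z \<le> norm (A *v z)"
proof -
  define B where "B = col_submatrix A K"
  define V where "V = {z :: real^'n. supp z \<subseteq> K}"
  define \<phi> where "\<phi> = (\<lambda>z. norm (A *v z))"
  have V: "subspace V"
    unfolding V_def by (rule subspace_supp_subset)
  have BA: "B *v y = A *v y" if "y \<in> V" for y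
    using that by (simp add: V_def B_def col_submatrix_mult)
  have cont: "continuous_on (sphere 0 1 \<inter> V) \<phi>"
    unfolding \<phi>_def by (intro continuous_intros)
  have comp: "compact (sphere 0 1 \<inter> V)"
    by (intro compact_Int_closed compact_sphere closed_subspace V)
  obtain k where "k \<in> K" using K by auto
  then have "axis k 1 \<in> sphere 0 1 \<inter> V"
    by (auto simp: V_def supp_subset_iff axis_def norm_axis_1[unfolded axis_def])
  then have ne: "sphere 0 1 \<inter> V \<noteq> {}" by blast
  obtain v where v: "norm v = 1" "v \<in> V"
    and min: "\<And>y. norm y = 1 \<Longrightarrow> y \<in> V \<Longrightarrow> \<phi> v \<le> \<phi> y"
    using continuous_attains_inf[OF comp ne cont] by auto
  have pos: "0 < \<phi> v"
    using inj[of v] v by (auto simp: \<phi>_def V_def)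
  have le: "\<phi> v * norm y \<le> norm (A *v y)" if y: "y \<in> V" for y
  proof (cases "y = 0")
    case False
    have "\<phi> v \<le> \<phi> (y /\<^sub>R norm y)"
      using False V y by (intro min subspace_scale) simp_all
    then show ?thesis
      using False by (simp add: \<phi>_def matrix_vector_mult_scaleR field_simps)
  qed simp
  have "transpose B *v (B *v v) = (\<phi> v)\<^sup>2 *\<^sub>R v"
  proof (rule extremal_imp_eigenvector[where V = V and \<kappa> = 1])
    fix z assume z: "z \<in> V"
    have "(\<phi> v)\<^sup>2 * (norm z)\<^sup>2 \<le> (norm (B *v z))\<^sup>2"
      using power_mono[OF le[OF z], of 2] pos by (simp add: power_mult_distrib BA z)
    then show "0 \<le> 1 * ((norm (B *v z))\<^sup>2 - (\<phi> v)\<^sup>2 * (norm z)\<^sup>2)"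
      by simp
  next
    show "transpose B *v (B *v v) \<in> V"
      unfolding V_def B_def using supp_transpose_col_submatrix by blast
  qed (use v V BA in \<open>auto simp: \<phi>_def\<close>)
  then have "sqrt ((\<phi> v)\<^sup>2) \<in> singular_values B"
    using v by (intro extremal_singular_value) auto
  then have sv: "\<phi> v \<in> {s \<in> singular_values B. 0 < s}"
    using pos by simp
  have fin: "finite {s \<in> singular_values B. 0 < s}"
    using finite_singular_values[of B] by simp
  have "\<sigma> \<in> {s \<in> singular_values B. 0 < s}"
    unfolding \<sigma>_def sigma_min_def B_def[symmetric] using sv fin by (intro Min_in) auto
  then show "0 < \<sigma>" by simp
  have "\<sigma> \<le> \<phi> v"
    unfolding \<sigma>_def sigma_min_def B_def[symmetric] using sv fin by (intro Min_le)
  then have "\<sigma> * norm z \<le> \<phi> v * norm z"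
    by (rule mult_right_mono) simp
  then show "\<sigma> * norm z \<le> norm (A *v z)" if "supp z \<subseteq> K"
    using le[of z] that by (auto simp: V_def)
qed

section \<open>Optimality and stability of LASSO solutions\<close>

lemma lasso_variational_inequality:
  fixes A :: "real^'n^'m"
  assumes x: "x \<in> lasso_sol A (b, lam)" and lam: "0 \<le> lam"
  shows "(b - A *v x) \<bullet> (A *v (z - x)) \<le> lam * (l1_norm z - l1_norm x)"
proof (rule ccontr)
  define D where "D = A *v (z - x)"
  define P where "P = (b - A *v x) \<bullet> D - lam * (l1_norm z - l1_norm x)"
  assume "\<not> ?thesis"
  then have P: "0 < P" by (simp add: P_def D_def)
  have le: "P \<le> t / 2 * (norm D)\<^sup>2" if t: "0 < t" "t \<le> 1" for t
  proof -
    define y where "y = x + t *\<^sub>R (z - x)"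
    have "lasso_objective A (b, lam) x \<le> lasso_objective A (b, lam) y"
      using x by (auto simp: lasso_sol_def is_arg_min_linorder)
    moreover have "(norm (A *v y - b))\<^sup>2
        = (norm (A *v x - b))\<^sup>2 - 2 * t * ((b - A *v x) \<bullet> D) + t\<^sup>2 * (norm D)\<^sup>2"
      unfolding power2_norm_eq_inner y_def D_def matrix_vector_right_distrib matrix_vector_mult_scaleR
      by (simp add: inner_add_left inner_add_right inner_diff_left inner_diff_right inner_commute
          algebra_simps power2_eq_square)
    moreover have "l1_norm y \<le> (1 - t) * l1_norm x + t * l1_norm z"
    proof -
      have "\<bar>y $ i\<bar> \<le> (1 - t) * \<bar>x $ i\<bar> + t * \<bar>z $ i\<bar>" for i
      proof -
        have "y $ i = (1 - t) * x $ i + t * z $ i"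
          by (simp add: y_def algebra_simps)
        then show ?thesis
          using abs_triangle_ineq[of "(1 - t) * x $ i" "t * z $ i"] t by (simp add: abs_mult)
      qed
      then show ?thesis
        unfolding l1_norm_def sum_distrib_left sum.distrib[symmetric] by (intro sum_mono)
    qed
    then have "lam * l1_norm y \<le> lam * ((1 - t) * l1_norm x + t * l1_norm z)"
      using lam by (rule mult_left_mono)
    ultimately have "t * P \<le> t * (t / 2 * (norm D)\<^sup>2)"
      by (simp add: lasso_objective_def P_def algebra_simps power2_eq_square)
    then show ?thesis
      using t by simp
  qed
  define N where "N = (norm D)\<^sup>2"
  \<comment> \<open>Small enough that the right-hand side of \<open>le\<close> falls below \<open>P\<close>.\<close>
  define t where "t = min 1 (P / (N + 1))"
  have N: "0 \<le> N" by (simp add: N_def)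
  have t: "0 < t" "t \<le> 1" "t \<le> P / (N + 1)"
    using P N by (auto simp: t_def)
  have "t * (N + 1) \<le> P"
    using t(3) N by (simp add: pos_le_divide_eq)
  moreover have "2 * P \<le> t * N"
    using le[OF t(1,2)] by (simp add: N_def)
  ultimately show False
    using P t(1) by (simp add: distrib_left)
qed

lemma lasso_KKT:
  fixes A :: "real^'n^'m"
  assumes x: "x \<in> lasso_sol A (b, lam)" and lam: "0 < lam"
  shows "\<bar>column i A \<bullet> (b - A *v x)\<bar> \<le> lam"
    and "x $ i \<noteq> 0 \<Longrightarrow> column i A \<bullet> (b - A *v x) = lam * sgn (x $ i)"
proof -
  define c where "c = column i A \<bullet> (b - A *v x)"
  have c: "c * t \<le> lam * (\<bar>x $ i + t\<bar> - \<bar>x $ i\<bar>)" for t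
  proof -
    define z where "z = x + t *\<^sub>R axis i 1"
    have "l1_norm z - l1_norm x = (\<Sum>j\<in>UNIV. \<bar>z $ j\<bar> - \<bar>x $ j\<bar>)"
      by (simp add: l1_norm_def sum_subtractf)
    also have "\<dots> = (\<Sum>j\<in>UNIV. if i = j then \<bar>x $ i + t\<bar> - \<bar>x $ i\<bar> else 0)"
      by (intro sum.cong) (auto simp: z_def axis_def)
    also have "\<dots> = \<bar>x $ i + t\<bar> - \<bar>x $ i\<bar>"
      by simp
    finally have "l1_norm z - l1_norm x = \<bar>x $ i + t\<bar> - \<bar>x $ i\<bar>" .
    moreover have "A *v (z - x) = t *\<^sub>R column i A"
      by (simp add: z_def matrix_vector_mult_scaleR matrix_vector_mult_basis)
    ultimately show ?thesis
      using lasso_variational_inequality[OF x, of z] lam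
      by (simp add: c_def inner_commute mult.commute)
  qed
  have "c * t \<le> lam * \<bar>t\<bar>" for t
  proof -
    have "lam * (\<bar>x $ i + t\<bar> - \<bar>x $ i\<bar>) \<le> lam * \<bar>t\<bar>"
      using lam by (intro mult_left_mono) auto
    then show ?thesis using c[of t] by linarith
  qed
  from this[of 1] this[of "-1"] have le: "\<bar>c\<bar> \<le> lam" by simp
  then show "\<bar>column i A \<bullet> (b - A *v x)\<bar> \<le> lam" by (simp add: c_def)
  assume xi: "x $ i \<noteq> 0"
  have "lam * \<bar>x $ i\<bar> \<le> c * x $ i"
    using c[of "- x $ i"] by simp
  then have "lam \<le> c * sgn (x $ i)"
  proof -
    have "lam * \<bar>x $ i\<bar> \<le> (c * sgn (x $ i)) * \<bar>x $ i\<bar>"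
      using \<open>lam * \<bar>x $ i\<bar> \<le> c * x $ i\<close> by (simp only: mult.assoc sgn_mult_abs)
    then show ?thesis
      using xi by simp
  qed
  then show "column i A \<bullet> (b - A *v x) = lam * sgn (x $ i)"
    using le xi unfolding c_def[symmetric] by (auto simp: sgn_if split: if_splits)
qed

lemma lasso_sol_nonempty:
  fixes A :: "real^'n^'m"
  assumes lam: "0 < lam"
  shows "lasso_sol A (b, lam) \<noteq> {}"
proof -
  define f where "f = lasso_objective A (b, lam)"
  define R where "R = f 0 / lam"
  have f: "f z = 1/2 * (norm (A *v z - b))\<^sup>2 + lam * l1_norm z" for z
    by (simp add: f_def lasso_objective_def)
  have R: "0 \<le> R"
    using lam by (simp add: R_def f l1_norm_def)
  have "continuous_on (cball 0 R) f"
    unfolding f l1_norm_def by (intro continuous_intros)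
  moreover have "cball (0 :: real^'n) R \<noteq> {}"
    using R by simp
  ultimately obtain v where v: "v \<in> cball 0 R" and min: "\<And>y. y \<in> cball 0 R \<Longrightarrow> f v \<le> f y"
    using continuous_attains_inf[OF compact_cball] by blast
  have "f v \<le> f y" for y
  proof (cases "norm y \<le> R")
    case True
    then show ?thesis using min by simp
  next
    case False
    have "f v \<le> f 0"
      using R by (intro min) simp
    also have "\<dots> = lam * R"
      using lam by (simp add: R_def)
    also have "\<dots> \<le> lam * l1_norm y"
      using False lam norm_le_l1_cart[of y] by (simp add: l1_norm_def)
    also have "\<dots> \<le> f y"
      by (simp add: f)
    finally show ?thesis .
  qed
  then have "v \<in> lasso_sol A (b, lam)"
    by (auto simp: lasso_sol_def is_arg_min_linorder f_def)
  then show ?thesis by blast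
qed

text \<open>
  The basic stability estimate.  Dividing the variational inequalities at the two solutions by
  their own regularization parameters eliminates the difference of the \<open>\<ell>\<^sub>1\<close> norms; in the result
  the parameter change is multiplied by the residual at \<open>x2\<close> only.
\<close>

lemma lasso_stability:
  fixes A :: "real^'n^'m"
  assumes x1: "x1 \<in> lasso_sol A (b1, lam1)" and x2: "x2 \<in> lasso_sol A (b2, lam2)"
    and lam: "0 < lam1" "0 < lam2"
  shows "(norm (A *v (x1 - x2)))\<^sup>2 \<le> (b1 - b2) \<bullet> (A *v (x1 - x2))
     - (lam1 - lam2) / lam2 * ((b2 - A *v x2) \<bullet> (A *v (x1 - x2)))"
proof -
  define D where "D = A *v (x1 - x2)"
  define P1 where "P1 = (b1 - A *v x1) \<bullet> D"
  define P2 where "P2 = (b2 - A *v x2) \<bullet> D"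
  have "A *v (x2 - x1) = - D"
    by (simp add: D_def matrix_vector_mult_diff_distrib)
  then have "lam1 * (l1_norm x1 - l1_norm x2) \<le> P1"
    using lasso_variational_inequality[OF x1, of x2] lam by (simp add: P1_def right_diff_distrib)
  moreover have "lam1 / lam2 * P2 \<le> lam1 / lam2 * (lam2 * (l1_norm x1 - l1_norm x2))"
    using lasso_variational_inequality[OF x2, of x1] lam
    by (intro mult_left_mono) (auto simp: P2_def D_def)
  ultimately have "lam1 / lam2 * P2 \<le> P1"
    using lam by simp
  moreover have "(norm D)\<^sup>2 = (b1 - b2) \<bullet> D - P1 + P2"
    unfolding power2_norm_eq_inner P1_def P2_def
    by (simp add: D_def matrix_vector_mult_diff_distrib inner_diff_left)
  moreover have "(lam1 - lam2) / lam2 = lam1 / lam2 - 1"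
    using lam by (simp add: diff_divide_distrib)
  ultimately show ?thesis
    unfolding D_def[symmetric] P2_def[symmetric] by (simp only: left_diff_distrib)
qed

lemma lasso_fit_diff_le:
  fixes A :: "real^'n^'m"
  assumes "x1 \<in> lasso_sol A (b1, lam1)" "x2 \<in> lasso_sol A (b2, lam2)" and lam: "0 < lam1" "0 < lam2"
  shows "norm (A *v (x1 - x2)) \<le> norm (b1 - b2) + \<bar>lam1 - lam2\<bar> / lam2 * norm (b2 - A *v x2)"
proof -
  define D where "D = A *v (x1 - x2)"
  have "norm D * norm D \<le> (b1 - b2) \<bullet> D - (lam1 - lam2) / lam2 * ((b2 - A *v x2) \<bullet> D)"
    using lasso_stability[OF assms] by (simp add: D_def power2_eq_square)
  also have "\<dots> \<le> norm (b1 - b2) * norm D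
      + \<bar>(lam1 - lam2) / lam2\<bar> * (norm (b2 - A *v x2) * norm D)"
  proof -
    have "- (p * q) \<le> \<bar>p\<bar> * r" if "\<bar>q\<bar> \<le> r" for p q r :: real
      using abs_ge_minus_self[of "p * q"] mult_left_mono[OF that, of "\<bar>p\<bar>"] by (simp add: abs_mult)
    from this[OF Cauchy_Schwarz_ineq2] norm_cauchy_schwarz[of "b1 - b2" D]
    show ?thesis
      by (metis add_mono diff_conv_add_uminus)
  qed
  also have "\<dots> = (norm (b1 - b2) + \<bar>lam1 - lam2\<bar> / lam2 * norm (b2 - A *v x2)) * norm D"
    using lam by (simp add: algebra_simps)
  finally have "norm D \<le> norm (b1 - b2) + \<bar>lam1 - lam2\<bar> / lam2 * norm (b2 - A *v x2)"
    if "D \<noteq> 0"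
    using that by simp
  moreover have "0 \<le> norm (b1 - b2) + \<bar>lam1 - lam2\<bar> / lam2 * norm (b2 - A *v x2)"
    using lam by simp
  ultimately show ?thesis
    unfolding D_def by fastforce
qed

text \<open>
  Residuals depend continuously on the data, for an arbitrary choice of solutions.
\<close>

lemma eventually_lasso_residual:
  fixes A :: "real^'n^'m"
  assumes x: "x \<in> lasso_sol A (b, lam)" and lam: "0 < lam"
    and P: "eventually P (nhds (b - A *v x, lam))"
  shows "eventually (\<lambda>u. 0 < snd u \<and> (\<forall>y\<in>lasso_sol A u. P (fst u - A *v y, snd u)))
    (nhds (b, lam))"
proof -
  obtain e where e: "0 < e" "\<And>p. dist p (b - A *v x, lam) < e \<Longrightarrow> P p"
    using P unfolding eventually_nhds_metric by blast
  define g where "g = (\<lambda>u. 2 * norm (fst u - b) + \<bar>snd u - lam\<bar> / lam * norm (b - A *v x)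
    + \<bar>snd u - lam\<bar>)"
  have "open ({u. 0 < snd u} \<inter> {u. g u < e})"
    unfolding g_def using lam
    by (intro open_Int open_Collect_less continuous_intros) auto
  then have "eventually (\<lambda>u. u \<in> {u. 0 < snd u} \<inter> {u. g u < e}) (nhds (b, lam))"
    using lam e by (intro eventually_nhds_in_open) (auto simp: g_def)
  then show ?thesis
  proof (eventually_elim, intro conjI ballI)
    fix u y
    assume u: "u \<in> {u. 0 < snd u} \<inter> {u. g u < e}"
    then show "0 < snd u" by simp
    assume yu: "y \<in> lasso_sol A u"
    obtain b' lam' where u': "u = (b', lam')" by fastforce
    have pos: "0 < snd (b', lam')" and g: "g (b', lam') < e" and y: "y \<in> lasso_sol A (b', lam')"
      using u yu by (auto simp: u')
    have eq: "(fst (b', lam') - A *v y, snd (b', lam')) - (b - A *v x, lam)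
        = ((b' - b) - A *v (y - x), lam' - lam)"
      by (simp add: matrix_vector_mult_diff_distrib)
    have "norm (A *v (y - x)) \<le> norm (b' - b) + \<bar>lam' - lam\<bar> / lam * norm (b - A *v x)"
      using lasso_fit_diff_le[OF y x] pos lam by simp
    then have "norm ((b' - b) - A *v (y - x)) + norm (lam' - lam) \<le> g (b', lam')"
      using norm_triangle_ineq4[of "b' - b" "A *v (y - x)"] by (simp add: g_def)
    then have "dist (fst (b', lam') - A *v y, snd (b', lam')) (b - A *v x, lam) < e"
      unfolding dist_norm eq using g norm_Pair_le[of "(b' - b) - A *v (y - x)" "lam' - lam"]
      by linarith
    then show "P (fst u - A *v y, snd u)"
      unfolding u' by (rule e(2))
  qed
qed

lemma supp_subset_equicorrelation_set:
  assumes "x \<in> lasso_sol A (b, lam)" "0 < lam"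
  shows "supp x \<subseteq> equicorrelation_set A b lam x"
  using lasso_KKT(2)[OF assms] assms(2)
  by (auto simp: supp_def equicorrelation_set_def sgn_if abs_mult)

text \<open>Strict inequality of the correlations off \<open>J\<close> persists, so nearby solutions live on \<open>J\<close>.\<close>

lemma eventually_supp_subset_equicorrelation_set:
  fixes A :: "real^'n^'m"
  assumes x: "x \<in> lasso_sol A (b, lam)" and lam: "0 < lam"
  shows "eventually (\<lambda>u. 0 < snd u \<and>
    (\<forall>y\<in>lasso_sol A u. supp y \<subseteq> equicorrelation_set A b lam x)) (nhds (b, lam))"
proof -
  define J where "J = equicorrelation_set A b lam x"
  have "eventually (\<lambda>p. \<forall>i\<in>-J. \<bar>column i A \<bullet> fst p\<bar> < snd p) (nhds (b - A *v x, lam))"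
  proof (rule eventually_ball_finite)
    show "\<forall>i\<in>-J. eventually (\<lambda>p. \<bar>column i A \<bullet> fst p\<bar> < snd p) (nhds (b - A *v x, lam))"
    proof
      fix i assume "i \<in> - J"
      then have "\<bar>column i A \<bullet> (b - A *v x)\<bar> < lam"
        using lasso_KKT(1)[OF x lam, of i] by (simp add: J_def equicorrelation_set_def)
      moreover have "open {p. \<bar>column i A \<bullet> fst p\<bar> < snd p}"
        by (intro open_Collect_less continuous_intros)
      ultimately show "eventually (\<lambda>p. \<bar>column i A \<bullet> fst p\<bar> < snd p) (nhds (b - A *v x, lam))"
        unfolding eventually_nhds by (intro exI[of _ "{p. \<bar>column i A \<bullet> fst p\<bar> < snd p}"]) auto
    qed
  qed simp
  from eventually_lasso_residual[OF x lam this] show ?thesis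
  proof eventually_elim
    case (elim u)
    have "y $ i = 0" if y: "y \<in> lasso_sol A u" and i: "i \<notin> J" for y i
    proof (rule ccontr)
      assume "y $ i \<noteq> 0"
      then have "\<bar>column i A \<bullet> (fst u - A *v y)\<bar> = snd u"
        using lasso_KKT(2)[of y A "fst u" "snd u" i] y elim by (auto simp: sgn_if abs_mult)
      then show False
        using elim y i by force
    qed
    then show ?case
      using elim by (auto simp: supp_subset_iff J_def)
  qed
qed

section \<open>The Lipschitz estimate\<close>

text \<open>
  Every \<open>L\<close> above the asserted bound is a Lipschitz constant near \<open>(b, lam)\<close>, for arbitrary choices of
  solutions.  With equal data this includes uniqueness of the solution.
\<close>

lemma lasso_lipschitz_near:
  fixes A :: "real^'n^'m"
  assumes x: "x \<in> lasso_sol A (b, lam)" and lam: "0 < lam"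
    and J: "J = equicorrelation_set A b lam x"
    and inj: "\<And>z. supp z \<subseteq> J \<Longrightarrow> A *v z = 0 \<Longrightarrow> z = 0"
    and L: "lasso_lipschitz_bound A b lam x J < L"
  obtains \<delta> where "0 < \<delta>" "\<And>u. u \<in> ball (b, lam) \<delta> \<Longrightarrow> 0 < snd u"
    and "\<And>u1 u2 y1 y2. \<lbrakk>u1 \<in> ball (b, lam) \<delta>; u2 \<in> ball (b, lam) \<delta>;
      y1 \<in> lasso_sol A u1; y2 \<in> lasso_sol A u2\<rbrakk> \<Longrightarrow> norm (y1 - y2) \<le> L * norm (u1 - u2)"
proof (cases "J = {}")
  case True
  obtain \<delta> where \<delta>: "0 < \<delta>" "\<And>u. dist u (b, lam) < \<delta> \<Longrightarrow>
      0 < snd u \<and> (\<forall>y\<in>lasso_sol A u. supp y \<subseteq> J)"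
    using eventually_supp_subset_equicorrelation_set[OF x lam]
    unfolding eventually_nhds_metric J by blast
  have "norm (y1 - y2) \<le> L * norm (u1 - u2)"
    if "u1 \<in> ball (b, lam) \<delta>" "u2 \<in> ball (b, lam) \<delta>" "y1 \<in> lasso_sol A u1" "y2 \<in> lasso_sol A u2"
    for u1 u2 y1 y2
  proof -
    have "supp y1 \<subseteq> {}" "supp y2 \<subseteq> {}"
      using \<delta>(2)[of u1] \<delta>(2)[of u2] that True by (auto simp: dist_commute)
    then have "y1 = y2"
      by (simp add: supp_def vec_eq_iff)
    then show ?thesis
      using L True by (simp add: lasso_lipschitz_bound_def)
  qed
  then show ?thesis
    using \<delta> that[of \<delta>] by (auto simp: dist_commute)
next
  case False
  define B where "B = col_submatrix A J"
  define \<sigma> where "\<sigma> = sigma_min B"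
  define \<phi> where "\<phi> = (\<lambda>p. norm (transpose B *v fst p) / snd p)"
  \<comment> \<open>The threshold for \<open>\<phi>\<close> at which the estimate below has exactly the constant \<open>L\<close>.\<close>
  define C where "C = \<sigma>\<^sup>2 * L - sigma_max B"
  have \<sigma>: "0 < \<sigma>" "\<And>z. supp z \<subseteq> J \<Longrightarrow> \<sigma> * norm z \<le> norm (A *v z)"
    using sigma_min_mult_norm_le[OF inj False] by (auto simp: \<sigma>_def B_def)
  have "lasso_lipschitz_bound A b lam x J
      = (sigma_max B + \<phi> (b - A *v x, lam)) / \<sigma>\<^sup>2"
  proof -
    have "transpose B *v (A *v x - b) = - (transpose B *v (b - A *v x))"
      by (simp add: matrix_vector_mult_diff_distrib)
    then show ?thesis
      using False lam by (simp add: lasso_lipschitz_bound_def \<phi>_def \<sigma>_def B_def[symmetric])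
  qed
  then have "(sigma_max B + \<phi> (b - A *v x, lam)) / \<sigma>\<^sup>2 < L"
    using L by simp
  then have \<phi>: "\<phi> (b - A *v x, lam) < C"
    using \<sigma>(1) by (simp add: C_def pos_divide_less_eq mult.commute)
  have "eventually (\<lambda>p. \<phi> p < C) (nhds (b - A *v x, lam))"
  proof -
    have "(\<phi> \<longlongrightarrow> norm (transpose B *v fst (b - A *v x, lam)) / snd (b - A *v x, lam))
        (nhds (b - A *v x, lam))"
      unfolding \<phi>_def using lam
      by (intro tendsto_divide tendsto_norm tendsto_fst tendsto_snd filterlim_ident
          bounded_linear.tendsto[OF matrix_vector_mul_bounded_linear]) auto
    then have "(\<phi> \<longlongrightarrow> \<phi> (b - A *v x, lam)) (nhds (b - A *v x, lam))"
      by (simp add: \<phi>_def)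
    then show ?thesis
      using \<phi> by (rule order_tendstoD)
  qed
  from eventually_conj[OF eventually_lasso_residual[OF x lam this]
      eventually_supp_subset_equicorrelation_set[OF x lam]]
  obtain \<delta> where \<delta>: "0 < \<delta>" "\<And>u. dist u (b, lam) < \<delta> \<Longrightarrow>
      0 < snd u \<and> (\<forall>y\<in>lasso_sol A u. \<phi> (fst u - A *v y, snd u) < C \<and> supp y \<subseteq> J)"
    unfolding eventually_nhds_metric J by blast
  have "norm (y1 - y2) \<le> L * norm (u1 - u2)"
    if u: "u1 \<in> ball (b, lam) \<delta>" "u2 \<in> ball (b, lam) \<delta>"
      and y: "y1 \<in> lasso_sol A u1" "y2 \<in> lasso_sol A u2" for u1 u2 y1 y2
  proof -
    obtain b1 l1 b2 l2 where u12: "u1 = (b1, l1)" "u2 = (b2, l2)"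
      by fastforce
    have pos: "0 < l1" "0 < l2" and \<phi>2: "\<phi> (b2 - A *v y2, l2) < C"
      and supp: "supp y1 \<subseteq> J" "supp y2 \<subseteq> J"
      using \<delta>(2)[of u1] \<delta>(2)[of u2] u y by (auto simp: dist_commute u12)
    define \<Delta> where "\<Delta> = y1 - y2"
    have s\<Delta>: "supp \<Delta> \<subseteq> J"
      unfolding \<Delta>_def using supp by (rule supp_diff_subset)
    then have BA: "A *v \<Delta> = B *v \<Delta>"
      by (simp add: B_def col_submatrix_mult)
    have db: "norm (b1 - b2) \<le> norm (u1 - u2)" and dl: "\<bar>l1 - l2\<bar> \<le> norm (u1 - u2)"
      using norm_fst_le[of "b1 - b2" "l1 - l2"] norm_snd_le[of "l1 - l2" "b1 - b2"]
      by (auto simp: u12)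
    have fit: "(b1 - b2) \<bullet> (A *v \<Delta>) \<le> norm (u1 - u2) * (sigma_max B * norm \<Delta>)"
    proof -
      have "(b1 - b2) \<bullet> (A *v \<Delta>) \<le> norm (b1 - b2) * norm (A *v \<Delta>)"
        by (rule norm_cauchy_schwarz)
      also have "\<dots> \<le> norm (u1 - u2) * (sigma_max B * norm \<Delta>)"
        unfolding BA using norm_mult_le_sigma_max[of B] db by (intro mult_mono) auto
      finally show ?thesis .
    qed
    have par: "- ((l1 - l2) / l2 * ((b2 - A *v y2) \<bullet> (A *v \<Delta>)))
        \<le> norm (u1 - u2) * (\<phi> (b2 - A *v y2, l2) * norm \<Delta>)"
    proof -
      have "- ((l1 - l2) / l2 * ((b2 - A *v y2) \<bullet> (A *v \<Delta>)))
          \<le> \<bar>l1 - l2\<bar> / l2 * \<bar>(b2 - A *v y2) \<bullet> (A *v \<Delta>)\<bar>"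
        using abs_ge_minus_self[of "(l1 - l2) / l2 * ((b2 - A *v y2) \<bullet> (A *v \<Delta>))"] pos
        by (simp add: abs_mult)
      also have "\<dots> \<le> norm (u1 - u2) / l2 * (norm (transpose B *v (b2 - A *v y2)) * norm \<Delta>)"
        unfolding BA inner_matrix_vector_mult[of _ B]
        using dl pos by (intro mult_mono divide_right_mono Cauchy_Schwarz_ineq2) auto
      also have "\<dots> = norm (u1 - u2) * (\<phi> (b2 - A *v y2, l2) * norm \<Delta>)"
        by (simp add: \<phi>_def)
      finally show ?thesis .
    qed
    have "(\<sigma> * norm \<Delta>)\<^sup>2 \<le> (norm (A *v \<Delta>))\<^sup>2"
      using \<sigma> s\<Delta> by (intro power_mono) auto
    also have "\<dots> \<le> (b1 - b2) \<bullet> (A *v \<Delta>) - (l1 - l2) / l2 * ((b2 - A *v y2) \<bullet> (A *v \<Delta>))"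
      unfolding \<Delta>_def using lasso_stability y pos u12 by blast
    also have "\<dots> \<le> norm (u1 - u2) * (sigma_max B * norm \<Delta>)
        + norm (u1 - u2) * (\<phi> (b2 - A *v y2, l2) * norm \<Delta>)"
      using fit par by linarith
    also have "\<dots> \<le> norm (u1 - u2) * (sigma_max B * norm \<Delta>) + norm (u1 - u2) * (C * norm \<Delta>)"
      using \<phi>2 by (intro add_left_mono mult_left_mono mult_right_mono) auto
    also have "\<dots> = \<sigma>\<^sup>2 * ((L * norm (u1 - u2)) * norm \<Delta>)"
      by (simp add: C_def algebra_simps)
    finally have "(\<sigma> * norm \<Delta>)\<^sup>2 \<le> \<sigma>\<^sup>2 * ((L * norm (u1 - u2)) * norm \<Delta>)" .
    moreover have "(\<sigma> * norm \<Delta>)\<^sup>2 = \<sigma>\<^sup>2 * (norm \<Delta> * norm \<Delta>)"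
      by (simp add: power_mult_distrib power2_eq_square)
    ultimately have "\<sigma>\<^sup>2 * (norm \<Delta> * norm \<Delta>) \<le> \<sigma>\<^sup>2 * ((L * norm (u1 - u2)) * norm \<Delta>)"
      by simp
    then have le: "norm \<Delta> * norm \<Delta> \<le> (L * norm (u1 - u2)) * norm \<Delta>"
      using \<sigma>(1) by (simp only: mult_le_cancel_left_pos zero_less_power)
    show ?thesis
    proof (cases "\<Delta> = 0")
      case True
      have "0 \<le> C"
        using \<phi>2 pos less_imp_le[OF le_less_trans[OF divide_nonneg_pos[OF norm_ge_zero] \<phi>2[unfolded \<phi>_def]]]
        by simp
      then have "0 \<le> \<sigma>\<^sup>2 * L"
        using norm_mult_le_sigma_max(1)[of B] by (simp add: C_def)
      then have "0 \<le> L"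
        using \<sigma>(1) by (simp add: zero_le_mult_iff)
      then show ?thesis
        using True by (simp add: \<Delta>_def)
    next
      case False
      then show ?thesis
        using le by (simp add: \<Delta>_def)
    qed
  qed
  then show ?thesis
    using \<delta> that[of \<delta>] by (auto simp: dist_commute)
qed

lemma lasso_single_value_near:
  fixes A :: "real^'n^'m"
  assumes x: "x \<in> lasso_sol A (b, lam)" and lam: "0 < lam"
    and J: "J = equicorrelation_set A b lam x"
    and inj: "\<And>z. supp z \<subseteq> J \<Longrightarrow> A *v z = 0 \<Longrightarrow> z = 0"
    and L: "lasso_lipschitz_bound A b lam x J < L"
  obtains \<delta> where "0 < \<delta>"
    and "\<And>u. u \<in> ball (b, lam) \<delta> \<Longrightarrow> lasso_sol A u = {single_value (lasso_sol A) u}"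
    and "\<And>u1 u2. \<lbrakk>u1 \<in> ball (b, lam) \<delta>; u2 \<in> ball (b, lam) \<delta>\<rbrakk> \<Longrightarrow>
      norm (single_value (lasso_sol A) u1 - single_value (lasso_sol A) u2) \<le> L * norm (u1 - u2)"
proof -
  obtain \<delta> where \<delta>: "0 < \<delta>" and pos: "\<And>u. u \<in> ball (b, lam) \<delta> \<Longrightarrow> 0 < snd u"
    and lip: "\<And>u1 u2 y1 y2. \<lbrakk>u1 \<in> ball (b, lam) \<delta>; u2 \<in> ball (b, lam) \<delta>;
      y1 \<in> lasso_sol A u1; y2 \<in> lasso_sol A u2\<rbrakk> \<Longrightarrow> norm (y1 - y2) \<le> L * norm (u1 - u2)"
    using lasso_lipschitz_near[OF x lam J inj L] by blast
  have single: "lasso_sol A u = {single_value (lasso_sol A) u}" if u: "u \<in> ball (b, lam) \<delta>" for u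
  proof -
    obtain y where y: "y \<in> lasso_sol A u"
      using lasso_sol_nonempty[OF pos[OF u], of A "fst u"] by auto
    have "z = y" if "z \<in> lasso_sol A u" for z
      using lip[OF u u that y] by simp
    then have "lasso_sol A u = {y}"
      using y by blast
    then show ?thesis
      by (simp add: single_value_def)
  qed
  show ?thesis
  proof (rule that[OF \<delta> single])
    fix u1 u2 assume u: "u1 \<in> ball (b, lam) \<delta>" "u2 \<in> ball (b, lam) \<delta>"
    have "single_value (lasso_sol A) u1 \<in> lasso_sol A u1" "single_value (lasso_sol A) u2 \<in> lasso_sol A u2"
      using single[OF u(1)] single[OF u(2)] by blast+
    then show "norm (single_value (lasso_sol A) u1 - single_value (lasso_sol A) u2)
        \<le> L * norm (u1 - u2)"
      by (rule lip[OF u])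
  qed
qed

lemma lasso_locally_lipschitz:
  fixes A :: "real^'n^'m"
  assumes x: "x \<in> lasso_sol A (b, lam)" and lam: "0 < lam"
    and J: "J = equicorrelation_set A b lam x"
    and inj: "\<And>z. supp z \<subseteq> J \<Longrightarrow> A *v z = 0 \<Longrightarrow> z = 0"
  shows "single_valued_near (lasso_sol A) (b, lam)"
    and "locally_lipschitz_at (single_value (lasso_sol A)) (b, lam)"
    and "lipschitz_modulus (single_value (lasso_sol A)) (b, lam)
      \<le> ereal (lasso_lipschitz_bound A b lam x J)"
proof -
  define s where "s = single_value (lasso_sol A)"
  define \<beta> where "\<beta> = lasso_lipschitz_bound A b lam x J"
  have \<beta>: "lasso_lipschitz_bound A b lam x J < \<bar>\<beta>\<bar> + 1"
    by (simp add: \<beta>_def)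
  obtain \<delta> where \<delta>: "0 < \<delta>"
    and single: "\<And>u. u \<in> ball (b, lam) \<delta> \<Longrightarrow> lasso_sol A u = {s u}"
    and lip: "\<And>u1 u2. \<lbrakk>u1 \<in> ball (b, lam) \<delta>; u2 \<in> ball (b, lam) \<delta>\<rbrakk> \<Longrightarrow>
      norm (s u1 - s u2) \<le> (\<bar>\<beta>\<bar> + 1) * norm (u1 - u2)"
    using lasso_single_value_near[OF x lam J inj \<beta>] unfolding s_def by blast
  show "single_valued_near (lasso_sol A) (b, lam)"
    unfolding single_valued_near_def is_singleton_def
    using \<delta> single by (intro exI[of _ "ball (b, lam) \<delta>"]) auto
  have "(\<bar>\<beta>\<bar> + 1)-lipschitz_on (ball (b, lam) \<delta>) s"
    using lip by (intro lipschitz_onI) (auto simp: dist_norm)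
  then show "locally_lipschitz_at (single_value (lasso_sol A)) (b, lam)"
    unfolding locally_lipschitz_at_def s_def[symmetric]
    using \<delta> by (intro exI[of _ "ball (b, lam) \<delta>"] exI[of _ "\<bar>\<beta>\<bar> + 1"]) auto
  show "lipschitz_modulus (single_value (lasso_sol A)) (b, lam) \<le> ereal \<beta>"
  proof (rule ereal_le_epsilon2)
    fix e :: real assume "0 < e"
    then have e: "lasso_lipschitz_bound A b lam x J < \<beta> + e"
      by (simp add: \<beta>_def)
    obtain \<delta> where \<delta>: "0 < \<delta>"
      and "\<And>u. u \<in> ball (b, lam) \<delta> \<Longrightarrow> lasso_sol A u = {s u}"
      and lip: "\<And>u1 u2. \<lbrakk>u1 \<in> ball (b, lam) \<delta>; u2 \<in> ball (b, lam) \<delta>\<rbrakk> \<Longrightarrow>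
        norm (s u1 - s u2) \<le> (\<beta> + e) * norm (u1 - u2)"
      using lasso_single_value_near[OF x lam J inj e] unfolding s_def by blast
    have "eventually (\<lambda>p. p \<in> ball (b, lam) \<delta> \<times> ball (b, lam) \<delta>) (nhds ((b, lam), (b, lam)))"
      using \<delta> by (intro eventually_nhds_in_open open_Times open_ball) simp
    then have "eventually (\<lambda>p. p \<in> ball (b, lam) \<delta> \<times> ball (b, lam) \<delta> \<and> p \<in> {(v, w). v \<noteq> w})
        (at ((b, lam), (b, lam)) within {(v, w). v \<noteq> w})"
      unfolding eventually_at_filter by (rule eventually_mono) blast
    then have "eventually (\<lambda>(v, w). ereal (norm (s v - s w) / norm (v - w)) \<le> ereal (\<beta> + e))
        (at ((b, lam), (b, lam)) within {(v, w). v \<noteq> w})"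
    proof eventually_elim
      case (elim p)
      obtain v w where p: "p = (v, w)" by (cases p)
      have "norm (s v - s w) \<le> (\<beta> + e) * norm (v - w)" "0 < norm (v - w)"
        using elim lip[of v w] by (simp_all add: p)
      then show ?case
        by (simp add: p pos_divide_le_eq)
    qed
    then have "lipschitz_modulus s (b, lam) \<le> ereal (\<beta> + e)"
      unfolding lipschitz_modulus_def by (intro Limsup_bounded) (auto elim!: eventually_mono)
    then show "lipschitz_modulus (single_value (lasso_sol A)) (b, lam) \<le> ereal \<beta> + ereal e"
      by (simp add: s_def)
  qed
qed

section \<open>Directional derivatives\<close>

text \<open>
  The optimality conditions of the LASSO, linearized at the solution \<open>x\<close> for the parameter
  perturbation \<open>(q, \<alpha>)\<close>.  With \<open>\<sigma>\<^sub>i\<close> the sign of the correlation of column \<open>i\<close> with the residual,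
  which for \<open>i\<close> in the equicorrelation set \<open>J\<close> is the quotient of that correlation and \<open>lam\<close>, they
  demand that \<open>w\<close> vanishes off \<open>J\<close>, that \<open>\<sigma>\<^sub>i A\<^sub>i\<^sup>T (q - A w) = \<alpha>\<close> on the
  support of \<open>x\<close>, and complementarity of \<open>\<sigma>\<^sub>i w\<^sub>i \<ge> 0\<close> and \<open>\<sigma>\<^sub>i A\<^sub>i\<^sup>T (q - A w) \<le> \<alpha>\<close> on the
  remaining part of \<open>J\<close>.
\<close>

definition critical_direction ::
    "real^'n^'m \<Rightarrow> real^'m \<Rightarrow> real \<Rightarrow> real^'n \<Rightarrow> real^'m \<Rightarrow> real \<Rightarrow> real^'n \<Rightarrow> bool" where
  "critical_direction A b lam x q \<alpha> w \<longleftrightarrow>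
     supp w \<subseteq> equicorrelation_set A b lam x \<and>
     (\<forall>i\<in>equicorrelation_set A b lam x.
        let \<sigma> = column i A \<bullet> (b - A *v x) / lam; g = column i A \<bullet> (q - A *v w) in
        (x $ i \<noteq> 0 \<or> w $ i \<noteq> 0 \<longrightarrow> g = \<alpha> * \<sigma>) \<and>
        (x $ i = 0 \<longrightarrow> 0 \<le> \<sigma> * w $ i \<and> \<sigma> * g \<le> \<alpha>))"

lemma critical_direction_scale:
  fixes A :: "real^'n^'m"
  assumes w: "critical_direction A b lam x q \<alpha> w" and t: "0 \<le> t"
  shows "critical_direction A b lam x (t *\<^sub>R q) (t * \<alpha>) (t *\<^sub>R w)"
proof -
  define \<sigma> where "\<sigma> i = column i A \<bullet> (b - A *v x) / lam" for i
  define g where "g i = column i A \<bullet> (q - A *v w)" for i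
  have g: "column i A \<bullet> (t *\<^sub>R q - A *v (t *\<^sub>R w)) = t * g i" for i
    unfolding g_def by (simp add: matrix_vector_mult_scaleR flip: scaleR_diff_right)
  show ?thesis
    unfolding critical_direction_def Let_def g \<sigma>_def[symmetric]
  proof (intro conjI ballI impI)
    show "supp (t *\<^sub>R w) \<subseteq> equicorrelation_set A b lam x"
      using w by (auto simp: critical_direction_def supp_subset_iff)
    fix i assume "i \<in> equicorrelation_set A b lam x"
    then have *: "x $ i \<noteq> 0 \<or> w $ i \<noteq> 0 \<Longrightarrow> g i = \<alpha> * \<sigma> i"
      "x $ i = 0 \<Longrightarrow> 0 \<le> \<sigma> i * w $ i" "x $ i = 0 \<Longrightarrow> \<sigma> i * g i \<le> \<alpha>"
      using w unfolding critical_direction_def Let_def g_def \<sigma>_def by blast+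
    show "t * g i = t * \<alpha> * \<sigma> i" if "x $ i \<noteq> 0 \<or> (t *\<^sub>R w) $ i \<noteq> 0"
      using that *(1) by auto
    assume "x $ i = 0"
    then show "0 \<le> \<sigma> i * (t *\<^sub>R w) $ i" "\<sigma> i * (t * g i) \<le> t * \<alpha>"
      using mult_left_mono[OF *(2) t] mult_left_mono[OF *(3) t] by (simp_all add: mult.left_commute)
  qed
qed

text \<open>Uniqueness is the monotonicity of complementarity, together with injectivity on \<open>J\<close>.\<close>

lemma critical_direction_unique:
  fixes A :: "real^'n^'m"
  assumes lam: "0 < lam"
    and inj: "\<And>z. supp z \<subseteq> equicorrelation_set A b lam x \<Longrightarrow> A *v z = 0 \<Longrightarrow> z = 0"
    and w: "critical_direction A b lam x q \<alpha> w" and w': "critical_direction A b lam x q \<alpha> w'"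
  shows "w = w'"
proof -
  define J where "J = equicorrelation_set A b lam x"
  define g where "g = (\<lambda>w i. column i A \<bullet> (q - A *v w))"
  have supp: "supp (w - w') \<subseteq> J"
    using w w' unfolding critical_direction_def J_def by (intro supp_diff_subset) auto
  have "0 \<le> (g w i - g w' i) * (w - w') $ i" for i
  proof (cases "i \<in> J \<and> x $ i = 0")
    case True
    define \<sigma> where "\<sigma> = column i A \<bullet> (b - A *v x) / lam"
    have "\<sigma> = 1 \<or> \<sigma> = -1"
      using True lam by (auto simp: J_def equicorrelation_set_def \<sigma>_def abs_if split: if_splits)
    then have \<sigma>: "\<sigma> * \<sigma> = 1" by auto
    have *: "0 \<le> \<sigma> * v $ i" "\<sigma> * g v i \<le> \<alpha>" "\<sigma> * v $ i = 0 \<or> \<sigma> * g v i = \<alpha>"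
      if "critical_direction A b lam x q \<alpha> v" for v
      using that True \<sigma> unfolding critical_direction_def Let_def J_def g_def
      by (auto simp: \<sigma>_def)
    have "0 \<le> (p - p') * (a - a')" if "0 \<le> a" "p \<le> \<alpha>" "a = 0 \<or> p = \<alpha>"
      "0 \<le> a'" "p' \<le> \<alpha>" "a' = 0 \<or> p' = \<alpha>" for a p a' p' :: real
    proof -
      have "(\<alpha> - p) * a = 0" "(\<alpha> - p') * a' = 0" "0 \<le> (\<alpha> - p) * a'" "0 \<le> (\<alpha> - p') * a"
        using that by auto
      moreover have "(p - p') * (a - a')
          = (\<alpha> - p') * a + (\<alpha> - p) * a' - (\<alpha> - p) * a - (\<alpha> - p') * a'"
        by (simp add: algebra_simps)
      ultimately show ?thesis by linarith
    qed
    from this[OF *[OF w] *[OF w']]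
    have "0 \<le> (\<sigma> * \<sigma>) * ((g w i - g w' i) * (w - w') $ i)"
      by (simp add: algebra_simps)
    then show ?thesis using \<sigma> by simp
  next
    case False
    have "g v i = \<alpha> * (column i A \<bullet> (b - A *v x) / lam)"
      if "critical_direction A b lam x q \<alpha> v" "i \<in> J" for v
      using that False unfolding critical_direction_def Let_def J_def g_def by auto
    then have "i \<in> J \<Longrightarrow> g w i = g w' i"
      using w w' by metis
    moreover have "i \<notin> J \<Longrightarrow> (w - w') $ i = 0"
      using supp by (auto simp: supp_subset_iff)
    ultimately show ?thesis
      by (cases "i \<in> J") (auto simp del: vector_minus_component)
  qed
  then have "0 \<le> (\<Sum>i\<in>UNIV. (g w i - g w' i) * (w - w') $ i)"
    by (intro sum_nonneg) auto
  also have "\<dots> = (A *v w' - A *v w) \<bullet> (A *v (w - w'))"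
    unfolding inner_matrix_vector_sum g_def by (simp add: inner_diff_right)
  also have "\<dots> = - (norm (A *v (w - w')))\<^sup>2"
    unfolding power2_norm_eq_inner matrix_vector_mult_diff_distrib
    by (simp add: inner_diff_left inner_diff_right inner_commute)
  finally have "A *v (w - w') = 0"
    by simp
  then show ?thesis
    using inj[of "w - w'"] supp by (simp add: J_def)
qed

lemma critical_direction_eq_lasso_derivative:
  fixes A :: "real^'n^'m"
  assumes x: "x \<in> lasso_sol A (b, lam)" and lam: "0 < lam"
    and inj: "\<And>z. supp z \<subseteq> equicorrelation_set A b lam x \<Longrightarrow> A *v z = 0 \<Longrightarrow> z = 0"
    and w: "critical_direction A b lam x q \<alpha> w"
  shows "supp x \<union> supp w \<subseteq> equicorrelation_set A b lam x"
    and "lasso_derivative A b lam x (supp x \<union> supp w) (q, \<alpha>) = w"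
proof -
  show sub: "supp x \<union> supp w \<subseteq> equicorrelation_set A b lam x"
    using supp_subset_equicorrelation_set[OF x lam] w by (auto simp: critical_direction_def)
  show "lasso_derivative A b lam x (supp x \<union> supp w) (q, \<alpha>) = w"
  proof (rule lasso_derivative_eqI)
    show "z = 0" if "supp z \<subseteq> supp x \<union> supp w" "A *v z = 0" for z
      using that sub inj by blast
    fix i assume i: "i \<in> supp x \<union> supp w"
    then have "column i A \<bullet> (q - A *v w) = \<alpha> * (column i A \<bullet> (b - A *v x) / lam)"
      using w sub unfolding critical_direction_def Let_def by (auto simp: supp_def)
    then show "column i A \<bullet> (q - A *v w) = \<alpha> / lam * (column i A \<bullet> (b - A *v x))"
      by simp
  qed auto
qed

text \<open>
  For nearby data, increments of the solution map satisfy the linearized conditions exactly, not just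
  to first order, because the signs of the correlations on \<open>J\<close> and those of the solution on the
  support of \<open>x\<close> are locally constant.
\<close>

lemma eventually_critical_direction:
  fixes A :: "real^'n^'m"
  assumes x: "x \<in> lasso_sol A (b, lam)" and lam: "0 < lam"
    and inj: "\<And>z. supp z \<subseteq> equicorrelation_set A b lam x \<Longrightarrow> A *v z = 0 \<Longrightarrow> z = 0"
  shows "eventually (\<lambda>u. \<forall>y\<in>lasso_sol A u.
    critical_direction A b lam x (fst u - b) (snd u - lam) (y - x)) (nhds (b, lam))"
proof -
  define J where "J = equicorrelation_set A b lam x"
  define c where "c i = column i A \<bullet> (b - A *v x)" for i
  have cJ: "\<bar>c i\<bar> = lam" if "i \<in> J" for i
    using that by (simp add: J_def equicorrelation_set_def c_def)
  have xJ: "supp x \<subseteq> J"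
    unfolding J_def by (rule supp_subset_equicorrelation_set[OF x lam])
  have near: "eventually (\<lambda>u. \<forall>i\<in>supp x. \<forall>y\<in>lasso_sol A u. norm (y - x) < \<bar>x $ i\<bar>) (nhds (b, lam))"
  proof (rule eventually_ball_finite)
    show "\<forall>i\<in>supp x. eventually (\<lambda>u. \<forall>y\<in>lasso_sol A u. norm (y - x) < \<bar>x $ i\<bar>) (nhds (b, lam))"
    proof
      fix i assume "i \<in> supp x"
      then have xi: "0 < \<bar>x $ i\<bar>" by (simp add: supp_def)
      define L where "L = \<bar>lasso_lipschitz_bound A b lam x J\<bar> + 1"
      have L: "0 < L" and less: "lasso_lipschitz_bound A b lam x J < L"
        by (simp_all add: L_def)
      obtain \<delta> where \<delta>: "0 < \<delta>" and "\<And>u. u \<in> ball (b, lam) \<delta> \<Longrightarrow> 0 < snd u"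
        and lip: "\<And>u1 u2 y1 y2. \<lbrakk>u1 \<in> ball (b, lam) \<delta>;
          u2 \<in> ball (b, lam) \<delta>; y1 \<in> lasso_sol A u1; y2 \<in> lasso_sol A u2\<rbrakk> \<Longrightarrow>
          norm (y1 - y2) \<le> L * norm (u1 - u2)"
        using lasso_lipschitz_near[OF x lam J_def inj[folded J_def] less] by blast
      have "norm (y - x) < \<bar>x $ i\<bar>"
        if u: "dist u (b, lam) < min \<delta> (\<bar>x $ i\<bar> / L)" and y: "y \<in> lasso_sol A u" for u y
      proof -
        have "norm (y - x) \<le> L * norm (u - (b, lam))"
          using u \<delta> by (intro lip y x) (auto simp: dist_commute)
        also have "\<dots> < L * (\<bar>x $ i\<bar> / L)"
          using u L by (intro mult_strict_left_mono) (auto simp: dist_norm)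
        finally show ?thesis using L by simp
      qed
      then show "eventually (\<lambda>u. \<forall>y\<in>lasso_sol A u. norm (y - x) < \<bar>x $ i\<bar>) (nhds (b, lam))"
        unfolding eventually_nhds_metric using \<delta> xi L
        by (intro exI[of _ "min \<delta> (\<bar>x $ i\<bar> / L)"]) auto
    qed
  qed simp
  have "eventually (\<lambda>p. \<forall>i\<in>J. 0 < c i * (column i A \<bullet> fst p)) (nhds (b - A *v x, lam))"
  proof (rule eventually_ball_finite)
    show "\<forall>i\<in>J. eventually (\<lambda>p. 0 < c i * (column i A \<bullet> fst p)) (nhds (b - A *v x, lam))"
    proof
      fix i assume i: "i \<in> J"
      have "c i \<noteq> 0"
        using cJ[OF i] lam by auto
      then have "0 < c i * (column i A \<bullet> (b - A *v x))"
        unfolding c_def[symmetric] by (auto simp: zero_less_mult_iff)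
      moreover have "open {p. 0 < c i * (column i A \<bullet> fst p)}"
        by (intro open_Collect_less continuous_intros)
      ultimately show "eventually (\<lambda>p. 0 < c i * (column i A \<bullet> fst p)) (nhds (b - A *v x, lam))"
        unfolding eventually_nhds by (intro exI[of _ "{p. 0 < c i * (column i A \<bullet> fst p)}"]) auto
    qed
  qed simp
  from near eventually_lasso_residual[OF x lam this]
    eventually_supp_subset_equicorrelation_set[OF x lam]
  show ?thesis
  proof (eventually_elim, intro ballI)
    fix u y
    assume near: "\<forall>i\<in>supp x. \<forall>y\<in>lasso_sol A u. norm (y - x) < \<bar>x $ i\<bar>"
      and sgn: "0 < snd u \<and> (\<forall>y\<in>lasso_sol A u.
        \<forall>i\<in>J. 0 < c i * (column i A \<bullet> fst (fst u - A *v y, snd u)))"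
      and sub: "0 < snd u \<and> (\<forall>y\<in>lasso_sol A u. supp y \<subseteq> equicorrelation_set A b lam x)"
      and y: "y \<in> lasso_sol A u"
    define c' where "c' i = column i A \<bullet> (fst u - A *v y)" for i
    have u: "0 < snd u" using sgn by blast
    have y': "y \<in> lasso_sol A (fst u, snd u)" using y by simp
    note KKT' = lasso_KKT[OF y' u, folded c'_def]
    have g: "column i A \<bullet> (fst u - b - A *v (y - x)) = c' i - c i" for i
      by (simp add: c'_def c_def matrix_vector_mult_diff_distrib inner_diff_right)
    show "critical_direction A b lam x (fst u - b) (snd u - lam) (y - x)"
      unfolding critical_direction_def Let_def g J_def[symmetric] c_def[symmetric]
    proof (intro conjI ballI)
      show "supp (y - x) \<subseteq> J"
        using sub y xJ by (intro supp_diff_subset) (auto simp: J_def)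
      fix i assume i: "i \<in> J"
      have cc': "0 < c i * c' i"
        using sgn y i by (simp add: c'_def)
      have ci: "c i = lam \<or> c i = - lam"
        using cJ[OF i] by auto
      have eq: "c' i - c i = (snd u - lam) * (c i / lam)" if "c' i = snd u * (c i / lam)"
        using that lam by (simp add: field_simps)
      have y_sgn: "c' i = snd u * (c i / lam)" if "y $ i \<noteq> 0"
        using KKT'(2)[OF that] ci cc' u lam
        by (auto simp: sgn_if zero_less_mult_iff split: if_splits)
      show "x $ i \<noteq> 0 \<or> (y - x) $ i \<noteq> 0 \<longrightarrow> c' i - c i = (snd u - lam) * (c i / lam)"
      proof
        assume *: "x $ i \<noteq> 0 \<or> (y - x) $ i \<noteq> 0"
        have "y $ i \<noteq> 0"
        proof (cases "x $ i = 0")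
          case False
          then have "norm (y - x) < \<bar>x $ i\<bar>"
            using near y by (auto simp: supp_def)
          then show ?thesis
            using component_le_norm_cart[of "y - x" i] by auto
        qed (use * in simp)
        then show "c' i - c i = (snd u - lam) * (c i / lam)"
          by (intro eq y_sgn)
      qed
      show "x $ i = 0 \<longrightarrow> 0 \<le> c i / lam * (y - x) $ i \<and> c i / lam * (c' i - c i) \<le> snd u - lam"
      proof (intro impI conjI)
        assume xi: "x $ i = 0"
        show "0 \<le> c i / lam * (y - x) $ i"
        proof (cases "y $ i = 0")
          case False
          then show ?thesis
            using KKT'(2)[OF False] ci cc' u lam xi
            by (auto simp: sgn_if zero_less_mult_iff split: if_splits)
        qed (use xi in simp)
        show "c i / lam * (c' i - c i) \<le> snd u - lam"
          using KKT'(1)[of i] ci lam by auto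
      qed
    qed
  qed
qed

text \<open>
  Consequently the solution map is exactly linear along short segments from \<open>(b, lam)\<close>, with the
  unique critical direction as slope.
\<close>

lemma lasso_directional_derivative:
  fixes A :: "real^'n^'m"
  assumes x: "x \<in> lasso_sol A (b, lam)" and lam: "0 < lam"
    and inj: "\<And>z. supp z \<subseteq> equicorrelation_set A b lam x \<Longrightarrow> A *v z = 0 \<Longrightarrow> z = 0"
  defines "s \<equiv> single_value (lasso_sol A)"
  shows "has_directional_derivative s (b, lam) d (directional_derivative s (b, lam) d)"
    and "critical_direction A b lam x q \<alpha> (directional_derivative s (b, lam) (q, \<alpha>))"
    and "\<exists>\<delta>>0. \<forall>t\<ge>0. \<forall>d. t * norm d < \<delta> \<longrightarrow>
      s ((b, lam) + t *\<^sub>R d) = x + t *\<^sub>R directional_derivative s (b, lam) d"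
proof -
  define J where "J = equicorrelation_set A b lam x"
  obtain \<delta>1 where \<delta>1: "0 < \<delta>1" "\<And>u. u \<in> ball (b, lam) \<delta>1 \<Longrightarrow> lasso_sol A u = {s u}"
    and "\<And>u1 u2. \<lbrakk>u1 \<in> ball (b, lam) \<delta>1; u2 \<in> ball (b, lam) \<delta>1\<rbrakk> \<Longrightarrow>
      norm (s u1 - s u2) \<le> (lasso_lipschitz_bound A b lam x J + 1) * norm (u1 - u2)"
    using lasso_single_value_near[OF x lam J_def inj[folded J_def] less_add_one] unfolding s_def by blast
  obtain \<delta>2 where \<delta>2: "0 < \<delta>2" "\<And>u y. dist u (b, lam) < \<delta>2 \<Longrightarrow> y \<in> lasso_sol A u \<Longrightarrow>
      critical_direction A b lam x (fst u - b) (snd u - lam) (y - x)"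
    using eventually_critical_direction[OF x lam inj] unfolding eventually_nhds_metric by blast
  define \<delta> where "\<delta> = min \<delta>1 \<delta>2"
  have \<delta>: "0 < \<delta>" using \<delta>1 \<delta>2 by (simp add: \<delta>_def)
  have crit: "critical_direction A b lam x (fst v) (snd v) (s ((b, lam) + v) - x)"
    if v: "norm v < \<delta>" for v
  proof -
    have "s ((b, lam) + v) \<in> lasso_sol A ((b, lam) + v)"
      using \<delta>1(2)[of "(b, lam) + v"] v by (simp add: \<delta>_def dist_norm)
    from \<delta>2(2)[OF _ this] show ?thesis
      using v by (simp add: \<delta>_def dist_norm)
  qed
  have ex: "\<exists>w. critical_direction A b lam x (fst d) (snd d) w" for d
  proof -
    define k where "k = norm d + 1"
    define t where "t = \<delta> / (2 * k)"
    have k: "0 < k" by (simp add: k_def add_nonneg_pos)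
    then have t: "0 < t" using \<delta> by (simp add: t_def)
    have "t * norm d < \<delta>"
    proof -
      have "t * norm d \<le> t * k"
        using t by (simp add: k_def)
      also have "\<dots> = \<delta> / 2"
        using k by (simp add: t_def)
      finally show ?thesis using \<delta> by simp
    qed
    then have "critical_direction A b lam x (t *\<^sub>R fst d) (t * snd d) (s ((b, lam) + t *\<^sub>R d) - x)"
      using crit[of "t *\<^sub>R d"] t by simp
    from critical_direction_scale[OF this, of "1 / t"] show ?thesis
      using t by auto
  qed
  define D where "D = (\<lambda>d. SOME w. critical_direction A b lam x (fst d) (snd d) w)"
  have D: "critical_direction A b lam x (fst d) (snd d) (D d)" for d
    unfolding D_def using ex by (rule someI_ex)
  have ray: "s ((b, lam) + t *\<^sub>R d) = x + t *\<^sub>R D d" if t: "0 \<le> t" "t * norm d < \<delta>" for t d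
  proof -
    have "critical_direction A b lam x (t *\<^sub>R fst d) (t * snd d) (s ((b, lam) + t *\<^sub>R d) - x)"
      using crit[of "t *\<^sub>R d"] t by simp
    from critical_direction_unique[OF lam inj this]
    have "critical_direction A b lam x (t *\<^sub>R fst d) (t * snd d) w \<Longrightarrow>
      s ((b, lam) + t *\<^sub>R d) - x = w" for w by blast
    moreover have "critical_direction A b lam x (t *\<^sub>R fst d) (t * snd d) (t *\<^sub>R D d)"
      using critical_direction_scale[OF D t(1)] .
    ultimately have "s ((b, lam) + t *\<^sub>R d) - x = t *\<^sub>R D d"
      by blast
    then show ?thesis by (simp add: algebra_simps)
  qed
  have has: "has_directional_derivative s (b, lam) d (D d)" for d
  proof -
    have "s (b, lam) = x"
      using ray[of 0 d] \<delta> by simp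
    then have "eventually (\<lambda>t. D d = (1 / t) *\<^sub>R (s ((b, lam) + t *\<^sub>R d) - s (b, lam))) (at_right 0)"
      unfolding eventually_at_right_field
    proof (intro exI[of _ "\<delta> / (norm d + 1)"] conjI allI impI)
      show "0 < \<delta> / (norm d + 1)"
        using \<delta> by (simp add: add_nonneg_pos)
      fix t assume t: "0 < t" "t < \<delta> / (norm d + 1)"
      then have "t * (norm d + 1) < \<delta>"
        by (simp add: pos_less_divide_eq add_nonneg_pos)
      then have "t * norm d < \<delta>"
        using t by (simp add: distrib_left)
      then show "D d = (1 / t) *\<^sub>R (s ((b, lam) + t *\<^sub>R d) - s (b, lam))"
        using ray[of t d] t \<open>s (b, lam) = x\<close> by simp
    qed
    then show ?thesis
      unfolding has_directional_derivative_def by (rule tendsto_eventually[OF eventually_mono]) simp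
  qed
  have dd: "directional_derivative s (b, lam) d = D d" for d
    unfolding directional_derivative_def
    using has[of d] by (intro the_equality)
      (auto simp: has_directional_derivative_def intro: tendsto_unique[OF trivial_limit_at_right_real])
  show "has_directional_derivative s (b, lam) d (directional_derivative s (b, lam) d)"
    unfolding dd by (rule has)
  show "critical_direction A b lam x q \<alpha> (directional_derivative s (b, lam) (q, \<alpha>))"
    unfolding dd using D[of "(q, \<alpha>)"] by simp
  show "\<exists>\<delta>>0. \<forall>t\<ge>0. \<forall>d. t * norm d < \<delta> \<longrightarrow>
      s ((b, lam) + t *\<^sub>R d) = x + t *\<^sub>R directional_derivative s (b, lam) d"
    unfolding dd using \<delta> ray by blast
qed

lemma locally_lipschitz_directional_derivative:
  fixes A :: "real^'n^'m"
  assumes x: "x \<in> lasso_sol A (b, lam)" and lam: "0 < lam"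
    and inj: "\<And>z. supp z \<subseteq> equicorrelation_set A b lam x \<Longrightarrow> A *v z = 0 \<Longrightarrow> z = 0"
  shows "locally_lipschitz_at (directional_derivative (single_value (lasso_sol A)) (b, lam)) d"
proof -
  define s where "s = single_value (lasso_sol A)"
  define J where "J = equicorrelation_set A b lam x"
  define L where "L = \<bar>lasso_lipschitz_bound A b lam x J\<bar> + 1"
  have less: "lasso_lipschitz_bound A b lam x J < L"
    by (simp add: L_def)
  obtain \<delta>1 where \<delta>1: "0 < \<delta>1"
    and "\<And>u. u \<in> ball (b, lam) \<delta>1 \<Longrightarrow> lasso_sol A u = {s u}"
    and lip: "\<And>u1 u2. \<lbrakk>u1 \<in> ball (b, lam) \<delta>1; u2 \<in> ball (b, lam) \<delta>1\<rbrakk> \<Longrightarrow>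
      norm (s u1 - s u2) \<le> L * norm (u1 - u2)"
    using lasso_single_value_near[OF x lam J_def inj[folded J_def] less] unfolding s_def by blast
  obtain \<delta>2 where \<delta>2: "0 < \<delta>2" and ray: "\<And>t d. \<lbrakk>0 \<le> t; t * norm d < \<delta>2\<rbrakk> \<Longrightarrow>
      s ((b, lam) + t *\<^sub>R d) = x + t *\<^sub>R directional_derivative s (b, lam) d"
    using lasso_directional_derivative(3)[OF x lam inj] unfolding s_def by blast
  have "norm (directional_derivative s (b, lam) d - directional_derivative s (b, lam) d')
      \<le> L * norm (d - d')" for d d'
  proof -
    define M where "M = norm d + norm d' + 1"
    define t where "t = min \<delta>1 \<delta>2 / (2 * M)"
    have M: "0 < M" "norm d \<le> M" "norm d' \<le> M" by (auto simp: M_def add_nonneg_pos)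
    have t: "0 < t" using M \<delta>1 \<delta>2 by (simp add: t_def)
    have "t * M = min \<delta>1 \<delta>2 / 2" using M(1) by (simp add: t_def)
    then have "t * M < min \<delta>1 \<delta>2" using \<delta>1 \<delta>2 by linarith
    then have small: "t * norm e < min \<delta>1 \<delta>2" if "norm e \<le> M" for e :: "(real^'m) \<times> real"
      using mult_left_mono[OF that, of t] t by linarith
    have "t * norm (directional_derivative s (b, lam) d - directional_derivative s (b, lam) d')
        = norm (s ((b, lam) + t *\<^sub>R d) - s ((b, lam) + t *\<^sub>R d'))"
      using ray[of t d] ray[of t d'] small[of d] small[of d'] t M
      by (simp flip: scaleR_diff_right)
    also have "\<dots> \<le> L * norm (((b, lam) + t *\<^sub>R d) - ((b, lam) + t *\<^sub>R d'))"
      using small[of d] small[of d'] t M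
      by (intro lip) (auto simp: dist_norm simp del: scaleR_Pair add_Pair)
    also have "\<dots> = t * (L * norm (d - d'))"
      using t by (simp flip: scaleR_diff_right)
    finally show ?thesis using t by simp
  qed
  then have "L-lipschitz_on UNIV (directional_derivative s (b, lam))"
    by (intro lipschitz_onI) (auto simp: dist_norm L_def)
  then show ?thesis
    unfolding locally_lipschitz_at_def s_def[symmetric] by blast
qed

section \<open>The nondegenerate case\<close>

text \<open>If \<open>J\<close> is the support of \<open>x\<close>, the only choice \<open>K = J\<close> makes the solution map locally affine.\<close>

lemma lasso_nondegenerate:
  fixes A :: "real^'n^'m"
  assumes x: "x \<in> lasso_sol A (b, lam)" and lam: "0 < lam"
    and I: "I = supp x" and J: "equicorrelation_set A b lam x = I"
    and inj: "\<And>z. supp z \<subseteq> I \<Longrightarrow> A *v z = 0 \<Longrightarrow> z = 0"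
  shows "continuously_differentiable_at (single_value (lasso_sol A)) (b, lam)"
    and "(single_value (lasso_sol A) has_derivative lasso_derivative A b lam x I) (at (b, lam))"
proof -
  define s where "s = single_value (lasso_sol A)"
  define T where "T = lasso_derivative A b lam x I"
  have inj': "z = 0" if "supp z \<subseteq> equicorrelation_set A b lam x" "A *v z = 0" for z
    using inj that J by blast
  obtain \<delta> where \<delta>: "0 < \<delta>"
    and ray: "\<And>t d. \<lbrakk>0 \<le> t; t * norm d < \<delta>\<rbrakk> \<Longrightarrow>
      s ((b, lam) + t *\<^sub>R d) = x + t *\<^sub>R directional_derivative s (b, lam) d"
    using lasso_directional_derivative(3)[OF x lam inj'] unfolding s_def by blast
  have crit: "critical_direction A b lam x q \<alpha> (directional_derivative s (b, lam) (q, \<alpha>))" for q \<alpha>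
    unfolding s_def by (rule lasso_directional_derivative(2)[OF x lam inj'])
  have "directional_derivative s (b, lam) (q, \<alpha>) = T (q, \<alpha>)" for q \<alpha>
  proof -
    have "supp x \<union> supp (directional_derivative s (b, lam) (q, \<alpha>)) = I"
      using critical_direction_eq_lasso_derivative(1)[OF x lam inj' crit[of q \<alpha>]] I J by blast
    then show ?thesis
      using critical_direction_eq_lasso_derivative(2)[OF x lam inj' crit[of q \<alpha>]] by (simp add: T_def)
  qed
  then have affine: "s u = x + T (u - (b, lam))" if "u \<in> ball (b, lam) \<delta>" for u
  proof -
    have "norm (u - (b, lam)) < \<delta>"
      using that by (simp add: dist_norm norm_minus_commute)
    then show ?thesis
      using ray[of 1 "u - (b, lam)"] \<open>\<And>q \<alpha>. directional_derivative s (b, lam) (q, \<alpha>) = T (q, \<alpha>)\<close>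
      by (cases u) simp
  qed
  have T: "bounded_linear T"
    unfolding T_def using linear_lasso_derivative by (simp add: linear_conv_bounded_linear)
  have deriv: "(s has_derivative T) (at u)" if u: "u \<in> ball (b, lam) \<delta>" for u
  proof (rule has_derivative_transform_within_open[OF _ open_ball u])
    have "((\<lambda>u. T (u - (b, lam))) has_derivative (\<lambda>v. T (v - 0))) (at u)"
      by (intro bounded_linear.has_derivative[OF T] derivative_intros)
    from has_derivative_add[OF has_derivative_const[of x] this]
    show "((\<lambda>u. x + T (u - (b, lam))) has_derivative T) (at u)"
      by simp
  qed (simp add: affine)
  show "(single_value (lasso_sol A) has_derivative lasso_derivative A b lam x I) (at (b, lam))"
    using deriv[of "(b, lam)"] \<delta> by (simp add: s_def T_def)
  show "continuously_differentiable_at (single_value (lasso_sol A)) (b, lam)"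
    unfolding continuously_differentiable_at_def s_def[symmetric]
    using \<delta> deriv
    by (intro exI[of _ "ball (b, lam) \<delta>"] exI[of _ "\<lambda>_. Blinfun T"])
      (auto simp: bounded_linear_Blinfun_apply[OF T])
qed

lemma equicorrelation_set_eq_supp:
  fixes A :: "real^'n^'m"
  assumes x: "x \<in> lasso_sol A (b, lam)" and lam: "0 < lam"
    and less: "infnorm (transpose (col_submatrix A (- supp x)) *v
      (b - col_submatrix A (supp x) *v subvector x (supp x))) < lam"
  shows "equicorrelation_set A b lam x = supp x"
proof
  show "supp x \<subseteq> equicorrelation_set A b lam x"
    by (rule supp_subset_equicorrelation_set[OF x lam])
  have "subvector x (supp x) = x"
    by (simp add: subvector_def supp_def vec_eq_iff)
  then have fit: "col_submatrix A (supp x) *v subvector x (supp x) = A *v x"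
    by (simp add: col_submatrix_mult)
  show "equicorrelation_set A b lam x \<subseteq> supp x"
  proof (rule ccontr)
    assume "\<not> ?thesis"
    then obtain i where i: "\<bar>column i A \<bullet> (b - A *v x)\<bar> = lam" "i \<notin> supp x"
      by (auto simp: equicorrelation_set_def)
    have "\<bar>(transpose (col_submatrix A (- supp x)) *v (b - A *v x)) $ i\<bar> < lam"
      using le_less_trans[OF component_le_infnorm_cart less] unfolding fit .
    then show False
      using i by (simp add: transpose_col_submatrix_component)
  qed
qed

section \<open>Regularity of the LASSO solution map\<close>

theorem theorem4p13:
  fixes A :: "real^'n^'m" and b :: "real^'m" and lam :: real and x :: "real^'n"
    and I J :: "'n set" and S :: "(real^'m) \<times> real \<Rightarrow> (real^'n) set"
    and s :: "(real^'m) \<times> real \<Rightarrow> real^'n"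
  assumes lam_pos: "0 < lam"
    and S: "S = lasso_sol A"
    and s: "s = single_value S"
    and x: "x \<in> S (b, lam)"
    and I: "I = supp x"
    and J: "J = equicorrelation_set A b lam x"
  shows
    "(full_col_rank_on A J \<longrightarrow>
        single_valued_near S (b, lam) \<and>
        locally_lipschitz_at s (b, lam) \<and>
        lipschitz_modulus s (b, lam) \<le> ereal (lasso_lipschitz_bound A b lam x J) \<and>
        directionally_differentiable s (b, lam) \<and>
        (\<forall>d. locally_lipschitz_at (directional_derivative s (b, lam)) d) \<and>
        (\<forall>q \<alpha>. \<exists>K. I \<subseteq> K \<and> K \<subseteq> J \<and>
           directional_derivative s (b, lam) (q, \<alpha>) = lasso_derivative A b lam x K (q, \<alpha>)))
     \<and>
     (full_col_rank_on A I \<and>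
      infnorm (transpose (col_submatrix A (- I)) *v (b - col_submatrix A I *v subvector x I)) < lam \<longrightarrow>
        single_valued_near S (b, lam) \<and>
        continuously_differentiable_at s (b, lam) \<and>
        (s has_derivative lasso_derivative A b lam x I) (at (b, lam)) \<and>
        locally_lipschitz_at s (b, lam) \<and>
        lipschitz_modulus s (b, lam) \<le> ereal (lasso_lipschitz_bound A b lam x I))"
proof (intro conjI impI; (elim conjE)?)
  note x' = x[unfolded S]
  {
    assume rk: "full_col_rank_on A J"
    have inj: "\<And>z. supp z \<subseteq> J \<Longrightarrow> A *v z = 0 \<Longrightarrow> z = 0"
      using full_col_rank_on_injective[OF rk] by blast
    note inj' = inj[unfolded J]
    note lip = lasso_locally_lipschitz[OF x' lam_pos J inj]
    show "single_valued_near S (b, lam)"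
      unfolding S by (rule lip(1))
    show "locally_lipschitz_at s (b, lam)"
      unfolding s S by (rule lip(2))
    show "lipschitz_modulus s (b, lam) \<le> ereal (lasso_lipschitz_bound A b lam x J)"
      unfolding s S by (rule lip(3))
    show "\<forall>d. locally_lipschitz_at (directional_derivative s (b, lam)) d"
      unfolding s S using locally_lipschitz_directional_derivative[OF x' lam_pos inj'] by blast
    show "directionally_differentiable s (b, lam)"
      unfolding s S directionally_differentiable_def
      using lasso_directional_derivative(1)[OF x' lam_pos inj'] by blast
    show "\<forall>q \<alpha>. \<exists>K. I \<subseteq> K \<and> K \<subseteq> J \<and>
        directional_derivative s (b, lam) (q, \<alpha>) = lasso_derivative A b lam x K (q, \<alpha>)"
    proof (intro allI)
      fix q \<alpha>
      have "critical_direction A b lam x q \<alpha> (directional_derivative s (b, lam) (q, \<alpha>))"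
        unfolding s S by (rule lasso_directional_derivative(2)[OF x' lam_pos inj'])
      from critical_direction_eq_lasso_derivative[OF x' lam_pos inj' this]
      show "\<exists>K. I \<subseteq> K \<and> K \<subseteq> J \<and>
          directional_derivative s (b, lam) (q, \<alpha>) = lasso_derivative A b lam x K (q, \<alpha>)"
        unfolding I J by (metis Un_upper1)
    qed
  }
  assume rk: "full_col_rank_on A I"
    and less: "infnorm (transpose (col_submatrix A (- I)) *v
      (b - col_submatrix A I *v subvector x I)) < lam"
  have inj: "\<And>z. supp z \<subseteq> I \<Longrightarrow> A *v z = 0 \<Longrightarrow> z = 0"
    using full_col_rank_on_injective[OF rk] by blast
  have JI: "equicorrelation_set A b lam x = I"
    using equicorrelation_set_eq_supp[OF x' lam_pos less[unfolded I]] I by simp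
  note lip = lasso_locally_lipschitz[OF x' lam_pos JI[symmetric] inj]
  note deriv = lasso_nondegenerate[OF x' lam_pos I JI inj]
  show "single_valued_near S (b, lam)"
    unfolding S by (rule lip(1))
  show "locally_lipschitz_at s (b, lam)"
    unfolding s S by (rule lip(2))
  show "lipschitz_modulus s (b, lam) \<le> ereal (lasso_lipschitz_bound A b lam x I)"
    unfolding s S by (rule lip(3))
  show "continuously_differentiable_at s (b, lam)"
    unfolding s S by (rule deriv(1))
  show "(s has_derivative lasso_derivative A b lam x I) (at (b, lam))"
    unfolding s S by (rule deriv(2))
qed

end
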